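(* Let $(A,e)$ be an ordered $P$-algebra, and let $p,q\in PA$. Suppose that $p\le q$ in the stochastic order and $e(p)=e(q)$. Then $p=q$.
   Context: An ordered metric space is a metric space $X$ with a partial order $\le$ whose graph $\{\le\}\subseteq X\times X$ is closed. A map is short if it is 1-Lipschitz. An ordered metric space $X$ is L-ordered if for all $x,y\in X$: $x\le y$ iff $f(x)\le f(y)$ for every short monotone $f:X\to\mathbb{R}$. $\mathsf{L\text{-}COMet}$ is the category of complete L-ordered metric spaces and short monotone maps. The ordered Kantorovich monad $(P,\delta,E)$ on $\mathsf{L\text{-}COMet}$: $PX$ is the set of Radon probability measures $p$ on $X$ of finite first moment ($\int f\,dp$ exists and is finite for every short $f:X\to\mathbb{R}$), with the Kantorovich–Wasserstein metric $d(p,q)=\inf_r\int d(x,y)\,dr(x,y)$ over couplings $r$ of $p,q$ (probability measures on $X\times X$ with marginals $p,q$), and the stochastic order: $p\le q$ iff some coupling of $p$ and $q$ is supported on $\{\le\}$ (gives measure zero to its complement). $Pf$ is pushforward, $\delta_X(x)=\delta_x$, and $E_X:PPX\to PX$ is averaging, $\int f\,d(E\mu)=\int_{PX}(\int_X f\,dp)\,d\mu(p)$. An ordered $P$-algebra is an Eilenberg–Moore algebra $(A,e:PA\to A)$ of this monad in $\mathsf{L\text{-}COMet}$. *)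

theory Defs
  imports "HOL-Probability.Probability"
begin

section \<open>Borel and Radon measures on a topology given by a carrier\<close>

definition borel_of :: "'a topology \<Rightarrow> 'a measure" where
  "borel_of T = sigma (topspace T) {U. openin T U}"

definition radon_prob :: "'a topology \<Rightarrow> 'a measure \<Rightarrow> bool" where
  "radon_prob T p \<longleftrightarrow>
     prob_space p \<and> sets p = sets (borel_of T) \<and>
     (\<forall>B\<in>sets p. emeasure p B = (SUP K\<in>{K. compactin T K \<and> K \<subseteq> B}. emeasure p K))"

text \<open>
  A metric space is a pair of a carrier and a distance function, as in \<^locale>\<open>Metric_space\<close>.
  The topology below makes sense for any distance function, so that the construction of the
  space of measures can be iterated without a prior proof that the Kantorovich distance is a
  metric. On a metric space it is the library's metric topology.
\<close>

definition dist_topology :: "'a set \<Rightarrow> ('a \<Rightarrow> 'a \<Rightarrow> real) \<Rightarrow> 'a topology" where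
  "dist_topology M d =
     topology (\<lambda>U. U \<subseteq> M \<and> (\<forall>x\<in>U. \<exists>r>0. \<forall>y\<in>M. d x y < r \<longrightarrow> y \<in> U))"

lemma openin_dist_topology:
  "openin (dist_topology M d) U \<longleftrightarrow> U \<subseteq> M \<and> (\<forall>x\<in>U. \<exists>r>0. \<forall>y\<in>M. d x y < r \<longrightarrow> y \<in> U)"
proof -
  let ?P = "\<lambda>U. U \<subseteq> M \<and> (\<forall>x\<in>U. \<exists>r>0. \<forall>y\<in>M. d x y < r \<longrightarrow> y \<in> U)"
  have "?P (S \<inter> T)" if S: "?P S" and T: "?P T" for S T
  proof (intro conjI ballI)
    show "S \<inter> T \<subseteq> M" using S by blast
    fix x assume x: "x \<in> S \<inter> T"
    obtain r where r: "r > 0" "\<forall>y\<in>M. d x y < r \<longrightarrow> y \<in> S" using S x by blast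
    obtain s where s: "s > 0" "\<forall>y\<in>M. d x y < s \<longrightarrow> y \<in> T" using T x by blast
    show "\<exists>t>0. \<forall>y\<in>M. d x y < t \<longrightarrow> y \<in> S \<inter> T"
      using r s by (intro exI[of _ "min r s"]) auto
  qed
  moreover have "?P (\<Union>\<K>)" if H: "\<forall>K\<in>\<K>. ?P K" for \<K>
  proof (intro conjI ballI)
    show "\<Union>\<K> \<subseteq> M" using H by blast
    fix x assume "x \<in> \<Union>\<K>"
    then obtain K where K: "K \<in> \<K>" "x \<in> K" by blast
    then obtain r where "r > 0" "\<forall>y\<in>M. d x y < r \<longrightarrow> y \<in> K" using H by meson
    with K show "\<exists>r>0. \<forall>y\<in>M. d x y < r \<longrightarrow> y \<in> \<Union>\<K>" by blast
  qed
  ultimately have "istopology ?P"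
    unfolding istopology_def by simp
  then show ?thesis
    by (simp add: dist_topology_def)
qed

lemma (in Metric_space) dist_topology_eq_mtopology: "dist_topology M d = mtopology"
proof -
  have "openin (dist_topology M d) U \<longleftrightarrow> openin mtopology U" for U
  proof -
    have "(\<forall>y\<in>M. d x y < r \<longrightarrow> y \<in> U) \<longleftrightarrow> mball x r \<subseteq> U" if "x \<in> M" for x r
      using that by (auto simp: subset_iff)
    then show ?thesis
      unfolding openin_dist_topology openin_mtopology Ball_def by (metis subsetD)
  qed
  then show ?thesis
    by (simp add: topology_eq)
qed

definition short_map ::
  "'a set \<Rightarrow> ('a \<Rightarrow> 'a \<Rightarrow> real) \<Rightarrow> 'b set \<Rightarrow> ('b \<Rightarrow> 'b \<Rightarrow> real) \<Rightarrow> ('a \<Rightarrow> 'b) \<Rightarrow> bool" where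
  "short_map M d N d' f \<longleftrightarrow> f \<in> M \<rightarrow> N \<and> (\<forall>x\<in>M. \<forall>y\<in>M. d' (f x) (f y) \<le> d x y)"

abbreviation short_fun :: "'a set \<Rightarrow> ('a \<Rightarrow> 'a \<Rightarrow> real) \<Rightarrow> ('a \<Rightarrow> real) \<Rightarrow> bool" where
  "short_fun M d \<equiv> short_map M d UNIV dist"

text \<open>Orders are relations \<open>R \<subseteq> M \<times> M\<close>, that is, they are identified with their graphs.\<close>

definition mono_rel :: "'a rel \<Rightarrow> 'b rel \<Rightarrow> ('a \<Rightarrow> 'b) \<Rightarrow> bool" where
  "mono_rel R S f \<longleftrightarrow> (\<forall>x y. (x, y) \<in> R \<longrightarrow> (f x, f y) \<in> S)"


section \<open>The ordered Kantorovich monad\<close>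

definition kant_space :: "'a set \<Rightarrow> ('a \<Rightarrow> 'a \<Rightarrow> real) \<Rightarrow> 'a measure set" where
  "kant_space M d =
     {p. radon_prob (dist_topology M d) p \<and> (\<forall>f. short_fun M d f \<longrightarrow> integrable p f)}"

text \<open>
  Couplings live on the Borel sets of the product topology. For non-separable spaces these can
  be more than the product sigma-algebra, which need not contain the graph of the order.
\<close>

definition couplings ::
  "'a set \<Rightarrow> ('a \<Rightarrow> 'a \<Rightarrow> real) \<Rightarrow> 'a measure \<Rightarrow> 'a measure \<Rightarrow> ('a \<times> 'a) measure set" where
  "couplings M d p q =
     {r. prob_space r \<and>
         sets r = sets (borel_of (prod_topology (dist_topology M d) (dist_topology M d))) \<and>
         distr r (borel_of (dist_topology M d)) fst = p \<and>
         distr r (borel_of (dist_topology M d)) snd = q}"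

definition kant_dist :: "'a set \<Rightarrow> ('a \<Rightarrow> 'a \<Rightarrow> real) \<Rightarrow> 'a measure \<Rightarrow> 'a measure \<Rightarrow> real" where
  "kant_dist M d p q =
     enn2real (INF r\<in>couplings M d p q. \<integral>\<^sup>+ z. ennreal (d (fst z) (snd z)) \<partial>r)"

definition stoch_order :: "'a set \<Rightarrow> ('a \<Rightarrow> 'a \<Rightarrow> real) \<Rightarrow> 'a rel \<Rightarrow> 'a measure rel" where
  "stoch_order M d R =
     {(p, q). p \<in> kant_space M d \<and> q \<in> kant_space M d \<and>
              (\<exists>r\<in>couplings M d p q. emeasure r (M \<times> M - R) = 0)}"

definition kant_delta :: "'a set \<Rightarrow> ('a \<Rightarrow> 'a \<Rightarrow> real) \<Rightarrow> 'a \<Rightarrow> 'a measure" where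
  "kant_delta M d x = return (borel_of (dist_topology M d)) x"

text \<open>The functor on maps with codomain \<open>(N, d')\<close>.\<close>

definition kant_map ::
  "'b set \<Rightarrow> ('b \<Rightarrow> 'b \<Rightarrow> real) \<Rightarrow> ('a \<Rightarrow> 'b) \<Rightarrow> 'a measure \<Rightarrow> 'b measure" where
  "kant_map N d' f p = distr p (borel_of (dist_topology N d')) f"

definition kant_avg :: "'a set \<Rightarrow> ('a \<Rightarrow> 'a \<Rightarrow> real) \<Rightarrow> 'a measure measure \<Rightarrow> 'a measure" where
  "kant_avg M d \<mu> =
     (THE m. m \<in> kant_space M d \<and>
             (\<forall>f. short_fun M d f \<longrightarrow> (\<integral>x. f x \<partial>m) = (\<integral>p. (\<integral>x. f x \<partial>p) \<partial>\<mu>)))"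


section \<open>Ordered algebras\<close>

locale ordered_Metric_space = Metric_space M d for M :: "'a set" and d +
  fixes R :: "'a rel"
  assumes partial_order: "partial_order_on M R"
    and closed_order: "closedin (prod_topology mtopology mtopology) R"

locale L_ordered_Metric_space = ordered_Metric_space M d R for M :: "'a set" and d R +
  assumes L_order: "\<lbrakk>x \<in> M; y \<in> M\<rbrakk> \<Longrightarrow>
    (x, y) \<in> R \<longleftrightarrow> (\<forall>f. short_fun M d f \<and> mono_rel R {(s, t). s \<le> t} f \<longrightarrow> f x \<le> f y)"

locale L_COMet = L_ordered_Metric_space M d R for M :: "'a set" and d R +
  assumes complete: "mcomplete"

locale ordered_P_algebra = L_COMet M d R for M :: "'a set" and d R +
  fixes e :: "'a measure \<Rightarrow> 'a"
  assumes short: "short_map (kant_space M d) (kant_dist M d) M d e"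
    and monotone: "mono_rel (stoch_order M d R) R e"
    and unit: "x \<in> M \<Longrightarrow> e (kant_delta M d x) = x"
    and assoc: "\<mu> \<in> kant_space (kant_space M d) (kant_dist M d) \<Longrightarrow>
                  e (kant_avg M d \<mu>) = e (kant_map M d e \<mu>)"

end

theory Submission
  imports Defs
begin

text \<open>
  Let \<open>r\<close> be a coupling of \<open>p\<close> and \<open>q\<close> supported on the order. If \<open>p \<noteq> q\<close>, then \<open>r\<close> charges a
  box \<open>B\<close>, the product of two balls of radius \<open>\<epsilon>\<close> with centres \<open>x\<close>, \<open>y\<close> at distance more than
  \<open>2 \<epsilon>\<close>. Conditioning \<open>r\<close> on \<open>B\<close> and on its complement splits \<open>p\<close> and \<open>q\<close> into convex
  combinations \<open>l p\<^sub>1 + (1 - l) p\<^sub>2\<close> and \<open>l q\<^sub>1 + (1 - l) q\<^sub>2\<close> with \<open>p\<^sub>1 \<le> q\<^sub>1\<close> and \<open>p\<^sub>2 \<le> q\<^sub>2\<close>.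
  In the algebra this gives
  \<open>e p = l e(p\<^sub>1) + (1 - l) e(p\<^sub>2) \<le> l e(q\<^sub>1) + (1 - l) e(p\<^sub>2) \<le> l e(q\<^sub>1) + (1 - l) e(q\<^sub>2) = e q\<close>,
  so \<open>e p = e q\<close> and antisymmetry force equality throughout. Convex combinations in the algebra can
  be cancelled, whence \<open>e(p\<^sub>1) = e(q\<^sub>1)\<close>. But \<open>e\<close> is short, so \<open>e(p\<^sub>1)\<close> is within \<open>\<epsilon>\<close> of \<open>x\<close> and
  \<open>e(q\<^sub>1)\<close> within \<open>\<epsilon>\<close> of \<open>y\<close>, a contradiction.
\<close>

section \<open>Borel sets\<close>

lemma space_borel_of [simp]: "space (borel_of T) = topspace T"
  by (simp add: borel_of_def space_measure_of_conv)

lemma sets_borel_of: "sets (borel_of T) = sigma_sets (topspace T) {U. openin T U}"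
  unfolding borel_of_def using openin_subset by (subst sets_measure_of) auto

lemma openin_sets_borel_of: "openin T U \<Longrightarrow> U \<in> sets (borel_of T)"
  by (simp add: sets_borel_of sigma_sets.Basic)

lemma closedin_sets_borel_of: "closedin T C \<Longrightarrow> C \<in> sets (borel_of T)"
  by (metis closedin_def double_diff openin_sets_borel_of order_refl sets.compl_sets space_borel_of)

lemma measurable_borel_ofI:
  assumes "f \<in> space M \<rightarrow> topspace T"
    and "\<And>U. openin T U \<Longrightarrow> f -` U \<inter> space M \<in> sets M"
  shows "f \<in> M \<rightarrow>\<^sub>M borel_of T"
  unfolding borel_of_def using assms by (intro measurable_measure_of) (auto dest: openin_subset)

lemma continuous_map_measurable_borel_of:
  assumes "continuous_map T T' f"
  shows "f \<in> borel_of T \<rightarrow>\<^sub>M borel_of T'"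
proof (rule measurable_borel_ofI)
  show "f \<in> space (borel_of T) \<rightarrow> topspace T'"
    using assms by (simp add: continuous_map_def)
  fix U assume "openin T' U"
  then have "openin T {x \<in> topspace T. f x \<in> U}"
    using assms by (simp add: continuous_map_def)
  moreover have "{x \<in> topspace T. f x \<in> U} = f -` U \<inter> space (borel_of T)"
    by auto
  ultimately show "f -` U \<inter> space (borel_of T) \<in> sets (borel_of T)"
    using openin_sets_borel_of by metis
qed

lemma topspace_dist_topology [simp]: "topspace (dist_topology M d) = M"
proof -
  have "openin (dist_topology M d) M"
    unfolding openin_dist_topology by (auto intro: exI[of _ 1])
  then show ?thesis
    by (metis openin_dist_topology openin_subset openin_topspace subset_antisym)
qed

text \<open>A radius that works at \<open>f x\<close> works at \<open>x\<close> as well. The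
  argument lives at the level of distance functions, so it also covers \<open>e\<close> on the space
  of measures under \<open>kant_dist\<close>.\<close>

lemma short_map_continuous:
  assumes f: "short_map M d N d' f"
  shows "continuous_map (dist_topology M d) (dist_topology N d') f"
  unfolding continuous_map_def topspace_dist_topology
proof (intro conjI allI impI)
  show "f \<in> M \<rightarrow> N"
    using f by (simp add: short_map_def)
  fix U assume U: "openin (dist_topology N d') U"
  show "openin (dist_topology M d) {x \<in> M. f x \<in> U}"
    unfolding openin_dist_topology
  proof (intro conjI ballI)
    fix x assume x: "x \<in> {x \<in> M. f x \<in> U}"
    then obtain r where r: "r > 0" "\<forall>y\<in>N. d' (f x) y < r \<longrightarrow> y \<in> U"
      using U unfolding openin_dist_topology by blast
    have "f y \<in> U" if "y \<in> M" "d x y < r" for y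
    proof -
      have "d' (f x) (f y) < r" "f y \<in> N"
        using f x that unfolding short_map_def by (auto intro: le_less_trans)
      then show ?thesis using r by blast
    qed
    then show "\<exists>r>0. \<forall>y\<in>M. d x y < r \<longrightarrow> y \<in> {x \<in> M. f x \<in> U}"
      using r(1) by blast
  qed auto
qed

lemma dist_topology_euclidean:
  "dist_topology UNIV dist = (euclidean :: 'a::metric_space topology)"
  using Met_TC.dist_topology_eq_mtopology by simp

lemma borel_of_euclidean: "borel_of (euclidean :: 'a::topological_space topology) = borel"
  by (simp add: borel_of_def borel_def)

lemma short_fun_measurable:
  fixes f :: "'a \<Rightarrow> real"
  assumes "short_fun M d f"
  shows "f \<in> borel_measurable (borel_of (dist_topology M d))"
  using continuous_map_measurable_borel_of[OF short_map_continuous[OF assms]]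
  by (simp add: dist_topology_euclidean borel_of_euclidean)

section \<open>Measures with finite support\<close>

text \<open>A Borel set \<open>B\<close> has the same mass as the finite set of atoms lying in it.
  That set is compact, and Borel because points are closed.\<close>

lemma radon_prob_finite_support:
  assumes w: "finite (set_pmf w)" and x: "range x \<subseteq> topspace T"
    and T1: "\<And>y. y \<in> topspace T \<Longrightarrow> closedin T {y}"
  shows "radon_prob T (distr (measure_pmf w) (borel_of T) x)"
proof -
  let ?p = "distr (measure_pmf w) (borel_of T) x"
  have x_meas [measurable]: "x \<in> measure_pmf w \<rightarrow>\<^sub>M borel_of T"
    using x by auto
  have "emeasure ?p B = (SUP K\<in>{K. compactin T K \<and> K \<subseteq> B}. emeasure ?p K)"
    if B: "B \<in> sets ?p" for B
  proof (rule antisym)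
    let ?K = "x ` set_pmf w \<inter> B"
    have fin: "finite ?K" "?K \<subseteq> topspace T"
      using w x by auto
    then have "closedin T (\<Union>y\<in>?K. {y})"
      by (intro closedin_Union) (use T1 in auto)
    then have K: "?K \<in> sets (borel_of T)"
      using closedin_sets_borel_of by simp
    have "emeasure ?p B = emeasure (measure_pmf w) (x -` B)"
      using B by (simp add: emeasure_distr[OF x_meas])
    also have "\<dots> = emeasure (measure_pmf w) (x -` ?K)"
      by (intro emeasure_eq_AE) (auto simp: AE_measure_pmf_iff)
    also have "\<dots> = emeasure ?p ?K"
      using K by (simp add: emeasure_distr[OF x_meas])
    also have "\<dots> \<le> (SUP K\<in>{K. compactin T K \<and> K \<subseteq> B}. emeasure ?p K)"
      using fin by (intro SUP_upper) (auto intro: finite_imp_compactin)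
    finally show "emeasure ?p B \<le> (SUP K\<in>{K. compactin T K \<and> K \<subseteq> B}. emeasure ?p K)" .
    show "(SUP K\<in>{K. compactin T K \<and> K \<subseteq> B}. emeasure ?p K) \<le> emeasure ?p B"
      using B by (intro SUP_least emeasure_mono) auto
  qed
  moreover have "prob_space ?p"
    by (intro measure_pmf.prob_space_distr) measurable
  ultimately show ?thesis
    unfolding radon_prob_def by simp
qed

text \<open>Used at two levels: on the carrier of the algebra and on its space of measures. This is
  why closed points are assumed instead of a metric.\<close>

lemma finite_support_in_kant_space:
  assumes w: "finite (set_pmf w)" and x: "range x \<subseteq> M"
    and T1: "\<And>y. y \<in> M \<Longrightarrow> closedin (dist_topology M d) {y}"
  shows "distr (measure_pmf w) (borel_of (dist_topology M d)) x \<in> kant_space M d"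
proof -
  have "x \<in> measure_pmf w \<rightarrow>\<^sub>M borel_of (dist_topology M d)"
    using x by auto
  then have "integrable (distr (measure_pmf w) (borel_of (dist_topology M d)) x) f"
    if "short_fun M d f" for f
    using short_fun_measurable[OF that] w
    by (simp add: integrable_distr_eq integrable_measure_pmf_finite)
  then show ?thesis
    unfolding kant_space_def using assms by (auto intro!: radon_prob_finite_support)
qed

lemma integral_finite_support:
  fixes f :: "'a \<Rightarrow> real"
  assumes "range x \<subseteq> M" "f \<in> borel_measurable (borel_of (dist_topology M d))"
  shows "(\<integral>y. f y \<partial>distr (measure_pmf w) (borel_of (dist_topology M d)) x) =
    measure_pmf.expectation w (\<lambda>i. f (x i))"
  using assms by (intro integral_distr) auto

section \<open>The Kantorovich space\<close>

lemma kant_spaceD: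
  assumes "p \<in> kant_space M d"
  shows "prob_space p" "sets p = sets (borel_of (dist_topology M d))" "space p = M"
    and "short_fun M d f \<Longrightarrow> integrable p f"
proof -
  show "prob_space p" and s: "sets p = sets (borel_of (dist_topology M d))"
    using assms by (auto simp: kant_space_def radon_prob_def)
  show "space p = M"
    using sets_eq_imp_space_eq[OF s] by simp
  show "short_fun M d f \<Longrightarrow> integrable p f"
    using assms by (auto simp: kant_space_def)
qed

lemma radon_prob_inner_compact:
  assumes p: "radon_prob T p" and B: "B \<in> sets p" and e: "e > 0"
  obtains K where "compactin T K" "K \<subseteq> B" "emeasure p B < emeasure p K + ennreal e"
proof -
  interpret prob_space p using p by (simp add: radon_prob_def)
  have SUP: "emeasure p B = (SUP K\<in>{K. compactin T K \<and> K \<subseteq> B}. emeasure p K)"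
    using p B by (simp add: radon_prob_def)
  have "\<exists>K. compactin T K \<and> K \<subseteq> B \<and> emeasure p B < emeasure p K + ennreal e"
  \<comment> \<open>Subtraction in \<open>ennreal\<close> truncates at 0, so subtracting
    \<open>e\<close> gives a strictly smaller number only for positive mass.\<close>
  proof (cases "emeasure p B = 0")
    case True
    then show ?thesis using e by (intro exI[of _ "{}"]) auto
  next
    case False
    then have "emeasure p B - ennreal e < emeasure p B"
      using e by (intro ennreal_between) (auto simp: zero_less_iff_neq_zero less_top[symmetric])
    then obtain K where K: "compactin T K" "K \<subseteq> B" "emeasure p B - ennreal e < emeasure p K"
      unfolding SUP less_SUP_iff by auto
    then have "emeasure p B < emeasure p K + ennreal e"
      by (cases "ennreal e \<le> emeasure p B")
        (auto simp: minus_less_iff_ennreal not_le intro: less_le_trans add_increasing)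
    with K show ?thesis by blast
  qed
  then show ?thesis using that by blast
qed

lemma (in Metric_space) compactin_sets_borel_of:
  "compactin mtopology K \<Longrightarrow> K \<in> sets (borel_of mtopology)"
  using closedin_sets_borel_of compactin_imp_closedin Hausdorff_space_mtopology by blast

text \<open>Domination by a multiple of \<open>p\<close> transfers both requirements: a compact
  \<open>K\<close> missing \<open>p\<close>-mass at most \<open>e / C\<close> misses
  \<open>q\<close>-mass at most \<open>e\<close>, and integrals of norms grow by at most the factor
  \<open>C\<close>. Conditioned measures enter the space this way.\<close>

lemma (in Metric_space) dominated_in_kant_space:
  assumes p: "p \<in> kant_space M d" and q: "prob_space q" "sets q = sets p"
    and C: "C > 0" "\<And>B. B \<in> sets p \<Longrightarrow> emeasure q B \<le> ennreal C * emeasure p B"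
  shows "q \<in> kant_space M d"
proof -
  interpret p: prob_space p using kant_spaceD[OF p] by simp
  interpret q: prob_space q by fact
  have sets_p: "sets p = sets (borel_of mtopology)"
    using kant_spaceD(2)[OF p] by (simp add: dist_topology_eq_mtopology)
  have rad: "radon_prob mtopology p"
    using p by (simp add: kant_space_def dist_topology_eq_mtopology)
  have "emeasure q B = (SUP K\<in>{K. compactin mtopology K \<and> K \<subseteq> B}. emeasure q K)" (is "_ = ?S")
    if B: "B \<in> sets q" for B
  proof (rule antisym)
    show "?S \<le> emeasure q B"
      using B by (intro SUP_least emeasure_mono) auto
    show "emeasure q B \<le> ?S"
    proof (rule ennreal_le_epsilon)
      fix e :: real assume e: "e > 0"
      obtain K where K: "compactin mtopology K" "K \<subseteq> B"
          "emeasure p B < emeasure p K + ennreal (e / C)"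
        using radon_prob_inner_compact[OF rad, of B "e / C"] B q C e by auto
      have Ks: "K \<in> sets p"
        using K sets_p compactin_sets_borel_of by simp
      have "emeasure p (B - K) = emeasure p B - emeasure p K"
        using K B Ks q by (intro emeasure_Diff) auto
      also have "\<dots> \<le> ennreal (e / C)"
        using K(3) by (simp add: ennreal_minus_le_iff less_imp_le)
      finally have "emeasure q (B - K) \<le> ennreal C * ennreal (e / C)"
        using C(2)[of "B - K"] B Ks q
        by (metis (no_types, lifting) mult_left_mono order_trans sets.Diff zero_le)
      also have "\<dots> = ennreal e"
        using C e by (simp flip: ennreal_mult)
      finally have "emeasure q (B - K) \<le> ennreal e" .
      moreover have "emeasure q B = emeasure q K + emeasure q (B - K)"
        using K B Ks q by (subst plus_emeasure) (auto intro!: arg_cong[where f = "emeasure q"])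
      moreover have "emeasure q K \<le> ?S"
        using K by (intro SUP_upper) auto
      ultimately show "emeasure q B \<le> ?S + ennreal e"
        by (simp add: add_mono)
    qed
  qed
  then have "radon_prob mtopology q"
    using q sets_p by (simp add: radon_prob_def)
  moreover have "integrable q f" if f: "short_fun M d f" for f
  proof (rule integrableI_bounded)
    have ip: "integrable p f" using kant_spaceD(4)[OF p f] .
    then show "f \<in> borel_measurable q"
      using borel_measurable_integrable[OF ip] q(2) by (simp cong: measurable_cong_sets)
    have "q \<le> scale_measure (ennreal C) p"
      using C q by (subst le_measure) (auto simp: le_fun_def)
    then have "(\<integral>\<^sup>+x. norm (f x) \<partial>q) \<le> (\<integral>\<^sup>+x. norm (f x) \<partial>scale_measure (ennreal C) p)"
      using q by (intro nn_integral_mono_measure) auto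
    also have "\<dots> = C * (\<integral>\<^sup>+x. norm (f x) \<partial>p)"
      using ip by (intro nn_integral_scale_measure) auto
    also have "\<dots> < \<infinity>"
      using ip by (simp add: integrable_iff_bounded ennreal_mult_less_top)
    finally show "(\<integral>\<^sup>+x. norm (f x) \<partial>q) < \<infinity>" .
  qed
  ultimately show ?thesis
    by (simp add: kant_space_def dist_topology_eq_mtopology)
qed

section \<open>Short functions determine a measure; separable sets of full measure\<close>

context Metric_space begin

lemma short_fun_dist:
  assumes "x \<in> M"
  shows "short_fun M d (\<lambda>y. d y x)"
  unfolding short_map_def dist_real_def
  using assms triangle commute by (smt (verit, best) Pi_UNIV UNIV_I)

text \<open>With \<open>h\<close> the distance to the complement of \<open>U\<close>, the functions
  \<open>min (1 / Suc n) (h x)\<close> are short, and multiplied by \<open>Suc n\<close> they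
  converge to the indicator of \<open>U\<close>. Equality of integrals survives the scaling by
  linearity, and dominated convergence concludes.\<close>

lemma kant_space_openin_integral:
  assumes p: "p \<in> kant_space M d" and q: "q \<in> kant_space M d"
    and eq: "\<And>f. short_fun M d f \<Longrightarrow> (\<integral>x. f x \<partial>p) = (\<integral>x. f x \<partial>q)"
    and U: "openin mtopology U"
  shows "emeasure p U = emeasure q U"
\<comment> \<open>For \<open>U = M\<close> the complement is empty and has no distance function;
  there both masses are 1.\<close>
proof (cases "U = M")
  case True
  then show ?thesis
    using kant_spaceD[OF p] kant_spaceD[OF q] by (metis prob_space.emeasure_space_1)
next
  case False
  define C where "C = M - U"
  have C: "C \<subseteq> M" "C \<noteq> {}"
    using False openin_subset[OF U] by (auto simp: C_def)
  define h where "h x = (INF y\<in>C. d x y)" for x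
  have h_le: "h x \<le> d x y" if "y \<in> C" for x y
    unfolding h_def using that by (intro cINF_lower) (auto intro!: bdd_belowI[of _ 0])
  have h_short: "h x \<le> d x z + h z" if "x \<in> M" "z \<in> M" for x z
  proof -
    have "h x - d x z \<le> h z"
      unfolding h_def[of z]
    proof (rule cINF_greatest)
      fix y assume y: "y \<in> C"
      then have "h x \<le> d x z + d z y"
        using h_le[OF y, of x] triangle[of x z y] that C by auto
      then show "h x - d x z \<le> d z y" by simp
    qed (use C in auto)
    then show ?thesis by simp
  qed
  have h_nonneg: "h x \<ge> 0" for x
    unfolding h_def using C by (intro cINF_greatest) auto
  have h_C: "h x = 0" if "x \<in> C" for x
    using h_le[of x x] that h_nonneg[of x] C by auto
  have h_U: "h x > 0" if x: "x \<in> U" for x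
  proof -
    obtain r where r: "r > 0" "mball x r \<subseteq> U"
      using U x unfolding openin_mtopology by blast
    have "r \<le> h x"
      unfolding h_def
    proof (rule cINF_greatest)
      fix y assume "y \<in> C"
      then have "y \<notin> mball x r" "y \<in> M" "x \<in> M"
        using r x openin_subset[OF U] by (auto simp: C_def)
      then show "r \<le> d x y"
        by auto
    qed (use C in auto)
    with r show ?thesis by simp
  qed
  \<comment> \<open>Capping preserves shortness and makes \<open>Suc n * f n x\<close> at most 1,
    which supplies the dominating function.\<close>
  define f where "f n x = min (1 / real (Suc n)) (h x)" for n :: nat and x
  have f_short: "short_fun M d (f n)" for n
    unfolding short_map_def dist_real_def f_def
  proof (intro conjI ballI)
    fix x y assume "x \<in> M" "y \<in> M"
    then show "\<bar>min (1 / real (Suc n)) (h x) - min (1 / real (Suc n)) (h y)\<bar> \<le> d x y"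
      using h_short[of x y] h_short[of y x] commute[of x y] by (auto simp: min_def abs_le_iff)
  qed auto
  have lim: "(\<lambda>n. real (Suc n) * f n x) \<longlonglongrightarrow> indicator U x" if x: "x \<in> M" for x
  proof (cases "x \<in> U")
    case True
    have "\<forall>\<^sub>F n in sequentially. 1 / real (Suc n) < h x"
      using h_U[OF True] LIMSEQ_inverse_real_of_nat order_tendstoD(2)
      by (fastforce simp: inverse_eq_divide)
    then have "\<forall>\<^sub>F n in sequentially. real (Suc n) * f n x = 1"
      by eventually_elim (auto simp: f_def min_def)
    then show ?thesis
      using True by (simp add: tendsto_eventually)
  next
    case False
    then show ?thesis using x h_C[of x] by (simp add: f_def C_def)
  qed
  have "(\<lambda>n. \<integral>x. real (Suc n) * f n x \<partial>m) \<longlonglongrightarrow> measure m U" if m: "m \<in> kant_space M d" for m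
  proof -
    interpret m: prob_space m using kant_spaceD[OF m] by simp
    have Us [measurable]: "U \<in> sets m"
      using openin_sets_borel_of[OF U] kant_spaceD(2)[OF m]
      by (simp add: dist_topology_eq_mtopology)
    have fm [measurable]: "f n \<in> borel_measurable m" for n
      using kant_spaceD(4)[OF m f_short] by (rule borel_measurable_integrable)
    have "(\<lambda>n. \<integral>x. real (Suc n) * f n x \<partial>m) \<longlonglongrightarrow> (\<integral>x. indicator U x \<partial>m)"
    proof (rule integral_dominated_convergence[where w = "\<lambda>_. 1"])
      show "AE x in m. (\<lambda>n. real (Suc n) * f n x) \<longlonglongrightarrow> indicator U x"
        using lim kant_spaceD(3)[OF m] by (intro AE_I2) simp
      have "real (Suc n) * min (1 / real (Suc n)) (h x) \<le> real (Suc n) * (1 / real (Suc n))" for n x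
        by (intro mult_left_mono) auto
      then show "AE x in m. norm (real (Suc n) * f n x) \<le> 1" for n
        using h_nonneg by (intro AE_I2) (simp add: f_def)
    qed auto
    then show ?thesis by simp
  qed
  moreover have "(\<integral>x. real (Suc n) * f n x \<partial>p) = (\<integral>x. real (Suc n) * f n x \<partial>q)" for n
    using eq[OF f_short] by simp
  ultimately have "measure p U = measure q U"
    using p q LIMSEQ_unique by (metis (no_types, lifting) ext)
  then show ?thesis
    using kant_spaceD(1)[OF p] kant_spaceD(1)[OF q]
    by (simp add: finite_measure.emeasure_eq_measure prob_space.finite_measure)
qed

text \<open>The open sets form an intersection-stable generator of the Borel sets. This gives
  uniqueness for the description in \<open>kant_avg\<close> and positivity of
  \<open>kant_dist\<close> off the diagonal.\<close>

lemma kant_space_eqI: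
  assumes p: "p \<in> kant_space M d" and q: "q \<in> kant_space M d"
    and eq: "\<And>f. short_fun M d f \<Longrightarrow> (\<integral>x. f x \<partial>p) = (\<integral>x. f x \<partial>q)"
  shows "p = q"
proof (rule measure_eqI_generator_eq)
  show "Int_stable {U. openin mtopology U}"
    by (auto simp: Int_stable_def)
  show "sets p = sigma_sets M {U. openin mtopology U}"
    "sets q = sigma_sets M {U. openin mtopology U}"
    using kant_spaceD(2)[OF p] kant_spaceD(2)[OF q]
    by (simp_all add: sets_borel_of dist_topology_eq_mtopology)
  show "emeasure p U = emeasure q U" if "U \<in> {U. openin mtopology U}" for U
    using kant_space_openin_integral[OF p q eq] that by auto
  show "range (\<lambda>_::nat. M) \<subseteq> {U. openin mtopology U}"
    using openin_topspace[of mtopology] by simp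
  show "emeasure p M \<noteq> \<infinity>"
    using prob_space.emeasure_space_1[OF kant_spaceD(1)[OF p]] kant_spaceD(3)[OF p] by simp
qed (use openin_subset[of mtopology] in auto)

text \<open>Inner regularity yields compact sets \<open>K n\<close> of mass above
  \<open>1 - 1 / Suc n\<close>, whose union has full measure. Each is totally bounded, and the union
  of all their finite nets is countable and approximates every point of the union.\<close>

lemma kant_space_separable:
  assumes p: "p \<in> kant_space M d"
  obtains D where "countable D" "D \<subseteq> M" "AE y in p. \<forall>e>0. \<exists>x\<in>D. d x y < e"
proof -
  interpret p: prob_space p using kant_spaceD[OF p] by simp
  have sets_p: "sets p = sets (borel_of mtopology)"
    using kant_spaceD(2)[OF p] by (simp add: dist_topology_eq_mtopology)
  have rad: "radon_prob mtopology p"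
    using p by (simp add: kant_space_def dist_topology_eq_mtopology)
  have "\<exists>K. compactin mtopology K \<and> emeasure p (space p) < emeasure p K + ennreal (1 / Suc n)" for n
    using radon_prob_inner_compact[OF rad, of "space p" "1 / Suc n"] by (metis of_nat_0_less_iff sets.top zero_less_Suc zero_less_divide_1_iff)
  then obtain K where K: "\<And>n. compactin mtopology (K n)"
      "\<And>n. emeasure p (space p) < emeasure p (K n) + ennreal (1 / Suc n)"
    by metis
  have Ks [measurable]: "K n \<in> sets p" for n
    using K(1) sets_p compactin_sets_borel_of by simp
  have "\<exists>F. finite F \<and> F \<subseteq> K n \<and> K n \<subseteq> (\<Union>x\<in>F. mball x (1 / Suc k))" for n k
    using compactin_imp_mtotally_bounded[OF K(1)[of n]] unfolding mtotally_bounded_def by auto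
  then obtain F where F: "\<And>n k. finite (F n k)" "\<And>n k. F n k \<subseteq> K n"
      "\<And>n k. K n \<subseteq> (\<Union>x\<in>F n k. mball x (1 / Suc k))"
    by metis
  let ?D = "\<Union>n k. F n k"
  have *: "1 \<le> measure p (\<Union>n. K n) + 1 / Suc n" for n
  proof -
    have "1 < ennreal (measure p (K n)) + ennreal (1 / Suc n)"
      using K(2)[of n] unfolding p.emeasure_space_1 by (simp add: p.emeasure_eq_measure)
    then have "1 < measure p (K n) + 1 / Suc n"
      using ennreal_less_iff[of 1] by (simp del: of_nat_Suc flip: ennreal_plus)
    moreover have "measure p (K n) \<le> measure p (\<Union>n. K n)"
      by (intro p.finite_measure_mono) auto
    ultimately show ?thesis by linarith
  qed
  have "1 \<le> measure p (\<Union>n. K n)"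
  proof (rule field_le_epsilon)
    fix e :: real assume "e > 0"
    then obtain n where "1 / Suc n < e" using nat_approx_posE by blast
    then show "1 \<le> measure p (\<Union>n. K n) + e" using *[of n] by linarith
  qed
  then have "p.prob (\<Union>n. K n) = 1"
    using p.prob_le_1 antisym by blast
  then have "AE y in p. y \<in> (\<Union>n. K n)"
    by (intro p.AE_prob_1)
  then have "AE y in p. \<forall>e>0. \<exists>x\<in>?D. d x y < e"
  proof eventually_elim
    case (elim y)
    then obtain n where n: "y \<in> K n" by blast
    show ?case
    proof (intro allI impI)
      fix e :: real assume "e > 0"
      then obtain k where k: "1 / Suc k < e" using nat_approx_posE by blast
      obtain x where "x \<in> F n k" "y \<in> mball x (1 / Suc k)" using F(3) n by blast
      then show "\<exists>x\<in>?D. d x y < e" using k by (intro bexI[of _ x]) auto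
    qed
  qed
  moreover have "countable ?D" by (simp add: F(1) countable_finite)
  moreover have "?D \<subseteq> M" using F(2) K(1) compactin_subset_topspace by fastforce
  ultimately show ?thesis using that by blast
qed

section \<open>Couplings and their cost\<close>

lemma measurable_fst_snd_prod_borel_of:
  "fst \<in> borel_of (prod_topology mtopology mtopology) \<rightarrow>\<^sub>M borel_of mtopology"
  "snd \<in> borel_of (prod_topology mtopology mtopology) \<rightarrow>\<^sub>M borel_of mtopology"
  by (intro continuous_map_measurable_borel_of continuous_map_fst continuous_map_snd)+

lemma couplingsD:
  assumes "r \<in> couplings M d p q"
  shows "prob_space r" "sets r = sets (borel_of (prod_topology mtopology mtopology))"
    "space r = M \<times> M"
    "distr r (borel_of mtopology) fst = p" "distr r (borel_of mtopology) snd = q"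
    "fst \<in> r \<rightarrow>\<^sub>M borel_of mtopology" "snd \<in> r \<rightarrow>\<^sub>M borel_of mtopology"
proof -
  show *: "prob_space r" "sets r = sets (borel_of (prod_topology mtopology mtopology))"
    "distr r (borel_of mtopology) fst = p" "distr r (borel_of mtopology) snd = q"
    using assms by (simp_all add: couplings_def dist_topology_eq_mtopology)
  show "space r = M \<times> M"
    using sets_eq_imp_space_eq[OF *(2)] by simp
  show "fst \<in> r \<rightarrow>\<^sub>M borel_of mtopology" "snd \<in> r \<rightarrow>\<^sub>M borel_of mtopology"
    using measurable_fst_snd_prod_borel_of *(2) by (simp_all cong: measurable_cong_sets)
qed


text \<open>
  A finite value of the cost excludes the junk value \<open>kant_dist M d p q = 0\<close> that
  \<^const>\<open>enn2real\<close> produces at infinity. The product measure only lives on the product sigma-algebra, so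
  it is first moved onto a separable set \<open>S \<times> S\<close> of full measure, on which every open set of the
  product topology is a countable union of boxes.
\<close>

lemma couplings_finite_cost:
  assumes p: "p \<in> kant_space M d" and q: "q \<in> kant_space M d"
  obtains r where "r \<in> couplings M d p q" "(\<integral>\<^sup>+ z. ennreal (d (fst z) (snd z)) \<partial>r) < \<infinity>"
proof -
  interpret p: prob_space p using kant_spaceD[OF p] by simp
  interpret q: prob_space q using kant_spaceD[OF q] by simp
  interpret pq: pair_prob_space p q ..
  let ?T = "prod_topology mtopology mtopology"
  have sets_p: "sets p = sets (borel_of mtopology)" and sets_q: "sets q = sets (borel_of mtopology)"
    using kant_spaceD(2)[OF p] kant_spaceD(2)[OF q] by (simp_all add: dist_topology_eq_mtopology)
  have sp: "space p = M" "space q = M" using kant_spaceD(3) p q by auto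
  obtain x0 where x0: "x0 \<in> M"
    using p.not_empty sp by auto
  obtain D1 where D1: "countable D1" "D1 \<subseteq> M" "AE y in p. \<forall>e>0. \<exists>x\<in>D1. d x y < e"
    using kant_space_separable[OF p] .
  obtain D2 where D2: "countable D2" "D2 \<subseteq> M" "AE y in q. \<forall>e>0. \<exists>x\<in>D2. d x y < e"
    using kant_space_separable[OF q] .
  define D where "D = D1 \<union> D2"
  \<comment> \<open>This is the set of points approximated by \<open>D\<close> to every precision,
    written with countably many balls so that it is visibly Borel.\<close>
  define S where "S = (\<Inter>n::nat. \<Union>x\<in>D. mball x (1 / Suc n))"
  have D: "countable D" "D \<subseteq> M" using D1 D2 by (auto simp: D_def)
  have ball_sets: "mball x e \<in> sets (borel_of mtopology)" for x e
    by (intro openin_sets_borel_of) simp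
  have S_sets: "S \<in> sets (borel_of mtopology)"
    unfolding S_def using D(1) ball_sets
    by (intro sets.countable_INT' sets.countable_UN') auto
  have AE_S: "AE y in p. y \<in> S" "AE y in q. y \<in> S"
  proof -
    have *: "y \<in> S" if "y \<in> M" "\<forall>e>0. \<exists>x\<in>D. d x y < e" for y
    proof -
      have "\<exists>x\<in>D. y \<in> mball x (1 / Suc n)" for n
        using that D(2) by (metis in_mball of_nat_0_less_iff subsetD zero_less_Suc zero_less_divide_1_iff)
      then show ?thesis by (auto simp: S_def)
    qed
    show "AE y in p. y \<in> S"
      using D1(3) AE_space by eventually_elim (intro *; auto simp: sp D_def)
    show "AE y in q. y \<in> S"
      using D2(3) AE_space by eventually_elim (intro *; auto simp: sp D_def)
  qed
  \<comment> \<open>The identity up to a null set: points outside \<open>S \<times> S\<close> are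
    sent to one fixed point, so that \<open>g\<close> is measurable into the larger sigma-algebra
    while the marginals stay the same.\<close>
  define g where "g z = (if z \<in> S \<times> S then z else (x0, x0))" for z
  have S_sub: "S \<subseteq> M" using S_sets sets.sets_into_space by fastforce
  have SS: "S \<times> S \<in> sets (p \<Otimes>\<^sub>M q)"
    using S_sets by (intro pair_measureI) (simp_all add: sets_p sets_q)
  have g_meas: "g \<in> p \<Otimes>\<^sub>M q \<rightarrow>\<^sub>M borel_of ?T"
  proof (rule measurable_borel_ofI)
    show "g \<in> space (p \<Otimes>\<^sub>M q) \<rightarrow> topspace ?T"
      using x0 by (auto simp: g_def space_pair_measure sp)
    fix U assume U: "openin ?T U"
    let ?B = "\<lambda>(x, y, n::nat). mball x (1 / Suc n) \<times> mball y (1 / Suc n)"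
    let ?I = "{i \<in> D \<times> D \<times> UNIV. ?B i \<subseteq> U}"
    have "U \<inter> S \<times> S = (\<Union>i\<in>?I. ?B i) \<inter> S \<times> S"
    proof (intro equalityI subsetI)
      fix z assume z: "z \<in> U \<inter> S \<times> S"
      obtain a b where ab: "z = (a, b)" by (cases z)
      obtain V W where VW: "openin mtopology V" "openin mtopology W" "a \<in> V" "b \<in> W" "V \<times> W \<subseteq> U"
        using U[unfolded openin_prod_topology_alt, rule_format, of a b] z ab by auto
      obtain e1 where e1: "e1 > 0" "mball a e1 \<subseteq> V" using VW(1,3) unfolding openin_mtopology by blast
      obtain e2 where e2: "e2 > 0" "mball b e2 \<subseteq> W" using VW(2,4) unfolding openin_mtopology by blast
      \<comment> \<open>Two points of a ball of radius \<open>1 / Suc n\<close> are less than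
        \<open>2 * e\<close> apart; halving makes the small ball about \<open>x\<close> fit into the
        one about \<open>a\<close>, and likewise for \<open>y\<close> and \<open>b\<close>.\<close>
      define e where "e = min e1 e2 / 2"
      have "e > 0" using e1 e2 by (simp add: e_def)
      then obtain n where n: "1 / Suc n < e" using nat_approx_posE by blast
      obtain x where x: "x \<in> D" "a \<in> mball x (1 / Suc n)" using z ab by (auto simp: S_def)
      obtain y where y: "y \<in> D" "b \<in> mball y (1 / Suc n)" using z ab by (auto simp: S_def)
      have "mball x (1 / Suc n) \<subseteq> mball a e1" "mball y (1 / Suc n) \<subseteq> mball b e2"
      proof -
        show "mball x (1 / Suc n) \<subseteq> mball a e1"
        proof
          fix u assume u: "u \<in> mball x (1 / Suc n)"
          then have "d a u \<le> d x a + d x u"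
            using x triangle[of a x u] by (auto simp: commute)
          with u x n show "u \<in> mball a e1" by (auto simp: e_def)
        qed
        show "mball y (1 / Suc n) \<subseteq> mball b e2"
        proof
          fix u assume u: "u \<in> mball y (1 / Suc n)"
          then have "d b u \<le> d y b + d y u"
            using y triangle[of b y u] by (auto simp: commute)
          with u y n show "u \<in> mball b e2" by (auto simp: e_def)
        qed
      qed
      then have "mball x (1 / Suc n) \<times> mball y (1 / Suc n) \<subseteq> V \<times> W"
        using e1(2) e2(2) by (intro Sigma_mono) auto
      then have I: "(x, y, n) \<in> ?I" and zB: "z \<in> ?B (x, y, n)"
        using x y ab VW(5) by auto
      have "z \<in> (\<Union>i\<in>?I. ?B i)"
        using I zB by (rule UN_I)
      then show "z \<in> (\<Union>i\<in>?I. ?B i) \<inter> S \<times> S" using z by simp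
    qed auto
    moreover have "(\<Union>i\<in>?I. ?B i) \<in> sets (p \<Otimes>\<^sub>M q)"
    proof (rule sets.countable_UN')
      have "countable (D \<times> D \<times> (UNIV :: nat set))" using D(1) by simp
      then show "countable ?I" by (rule countable_subset[rotated]) auto
      show "?B ` ?I \<subseteq> sets (p \<Otimes>\<^sub>M q)"
        using ball_sets by (auto intro!: pair_measureI simp: sets_p sets_q)
    qed
    ultimately have US: "U \<inter> S \<times> S \<in> sets (p \<Otimes>\<^sub>M q)"
      using SS by auto
    have "g -` U \<inter> space (p \<Otimes>\<^sub>M q) =
      (if (x0, x0) \<in> U then (U \<inter> S \<times> S) \<union> (space (p \<Otimes>\<^sub>M q) - S \<times> S) else U \<inter> S \<times> S)"
      using S_sub by (auto simp: g_def space_pair_measure sp split: if_splits)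
    then show "g -` U \<inter> space (p \<Otimes>\<^sub>M q) \<in> sets (p \<Otimes>\<^sub>M q)"
      using US SS by auto
  qed
  define r where "r = distr (p \<Otimes>\<^sub>M q) (borel_of ?T) g"
  have AE_g: "AE z in p \<Otimes>\<^sub>M q. g z = z"
  proof -
    have "AE z in p \<Otimes>\<^sub>M q. z \<in> S \<times> S"
    proof (rule pq.AE_pair_measure)
      show "{z \<in> space (p \<Otimes>\<^sub>M q). z \<in> S \<times> S} \<in> sets (p \<Otimes>\<^sub>M q)"
        using SS by simp
      show "AE x in p. AE y in q. (x, y) \<in> S \<times> S"
        using AE_S(1)
      proof eventually_elim
        case (elim x)
        show ?case using AE_S(2) by eventually_elim (use elim in auto)
      qed
    qed
    then show ?thesis by eventually_elim (auto simp: g_def)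
  qed
  note fst_snd = measurable_fst_snd_prod_borel_of
  have "distr r (borel_of mtopology) fst = p"
  proof -
    have "distr r (borel_of mtopology) fst = distr (p \<Otimes>\<^sub>M q) (borel_of mtopology) (fst \<circ> g)"
      unfolding r_def using fst_snd g_meas by (intro distr_distr)
    also have "\<dots> = distr (p \<Otimes>\<^sub>M q) p fst"
    proof (rule distr_cong_AE)
      show "AE z in p \<Otimes>\<^sub>M q. (fst \<circ> g) z = fst z"
        using AE_g by eventually_elim simp
      show "fst \<circ> g \<in> p \<Otimes>\<^sub>M q \<rightarrow>\<^sub>M borel_of mtopology"
        using fst_snd(1) g_meas by (rule measurable_comp[rotated])
    qed (simp_all add: sets_p)
    also have "\<dots> = p"
      by (rule q.distr_pair_fst)
    finally show ?thesis .
  qed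
  moreover have "distr r (borel_of mtopology) snd = q"
  proof -
    have "distr r (borel_of mtopology) snd = distr (p \<Otimes>\<^sub>M q) (borel_of mtopology) (snd \<circ> g)"
      unfolding r_def using fst_snd g_meas by (intro distr_distr)
    also have "\<dots> = distr (p \<Otimes>\<^sub>M q) q snd"
    proof (rule distr_cong_AE)
      show "AE z in p \<Otimes>\<^sub>M q. (snd \<circ> g) z = snd z"
        using AE_g by eventually_elim simp
      show "snd \<circ> g \<in> p \<Otimes>\<^sub>M q \<rightarrow>\<^sub>M borel_of mtopology"
        using fst_snd(2) g_meas by (rule measurable_comp[rotated])
    qed (simp_all add: sets_q)
    also have "\<dots> = q"
    proof (rule measure_eqI)
      fix A assume "A \<in> sets (distr (p \<Otimes>\<^sub>M q) q snd)"
      then have A: "A \<in> sets q" by simp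
      have "emeasure (distr (p \<Otimes>\<^sub>M q) q snd) A = emeasure (p \<Otimes>\<^sub>M q) (space p \<times> A)"
        using A sets.sets_into_space[OF A]
        by (auto simp: emeasure_distr space_pair_measure intro!: arg_cong[where f = "emeasure _"])
      then show "emeasure (distr (p \<Otimes>\<^sub>M q) q snd) A = emeasure q A"
        using A by (simp add: q.emeasure_pair_measure_Times p.emeasure_space_1)
    qed simp
    finally show ?thesis .
  qed
  moreover have "prob_space r"
    unfolding r_def by (intro pq.prob_space_distr g_meas)
  ultimately have r: "r \<in> couplings M d p q"
    by (simp add: couplings_def dist_topology_eq_mtopology r_def)
  have dm [measurable]: "(\<lambda>y. d y x0) \<in> borel_measurable (borel_of mtopology)"
    using short_fun_measurable[OF short_fun_dist[OF x0]] by (simp add: dist_topology_eq_mtopology)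
  note [measurable] = couplingsD(6,7)[OF r]
  \<comment> \<open>The cost is bounded by routing through \<open>x0\<close>; the two resulting
    terms are first moments of \<open>p\<close> and \<open>q\<close>.\<close>
  have "(\<integral>\<^sup>+ z. ennreal (d (fst z) (snd z)) \<partial>r) \<le> (\<integral>\<^sup>+ z. ennreal (d (fst z) x0) + ennreal (d (snd z) x0) \<partial>r)"
  proof (rule nn_integral_mono)
    fix z assume "z \<in> space r"
    then have "d (fst z) (snd z) \<le> d (fst z) x0 + d (snd z) x0"
      using couplingsD(3)[OF r] x0 triangle' by auto
    then show "ennreal (d (fst z) (snd z)) \<le> ennreal (d (fst z) x0) + ennreal (d (snd z) x0)"
      by (simp flip: ennreal_plus)
  qed
  also have "\<dots> = (\<integral>\<^sup>+ z. ennreal (d (fst z) x0) \<partial>r) + (\<integral>\<^sup>+ z. ennreal (d (snd z) x0) \<partial>r)"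
    by (intro nn_integral_add) measurable
  also have "(\<integral>\<^sup>+ z. ennreal (d (fst z) x0) \<partial>r) = (\<integral>\<^sup>+ y. ennreal (d y x0) \<partial>p)"
    by (subst couplingsD(4)[OF r, symmetric], subst nn_integral_distr) measurable
  also have "(\<integral>\<^sup>+ z. ennreal (d (snd z) x0) \<partial>r) = (\<integral>\<^sup>+ y. ennreal (d y x0) \<partial>q)"
    by (subst couplingsD(5)[OF r, symmetric], subst nn_integral_distr) measurable
  also have "(\<integral>\<^sup>+ y. ennreal (d y x0) \<partial>p) + (\<integral>\<^sup>+ y. ennreal (d y x0) \<partial>q) < \<infinity>"
    using kant_spaceD(4)[OF p short_fun_dist[OF x0]] kant_spaceD(4)[OF q short_fun_dist[OF x0]]
    by (simp add: integrable_iff_bounded)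
  finally show thesis
    using r that by blast
qed

section \<open>The Kantorovich distance\<close>

lemma integral_coupling_diff:
  \<comment> \<open>The easy half of Kantorovich duality: the coupling turns both integrals into
    integrals over one space, where shortness bounds the difference of the integrands by the
    distance.\<close>
  assumes p: "p \<in> kant_space M d" and q: "q \<in> kant_space M d" and r: "r \<in> couplings M d p q"
    and f: "short_fun M d f"
  shows "ennreal \<bar>(\<integral>x. f x \<partial>p) - (\<integral>x. f x \<partial>q)\<bar> \<le> (\<integral>\<^sup>+ z. ennreal (d (fst z) (snd z)) \<partial>r)"
proof -
  note [measurable] = couplingsD(6,7)[OF r]
  have fm [measurable]: "f \<in> borel_measurable (borel_of mtopology)"
    using short_fun_measurable[OF f] by (simp add: dist_topology_eq_mtopology)
  have int: "integrable r (\<lambda>z. f (fst z))" "integrable r (\<lambda>z. f (snd z))"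
    using kant_spaceD(4)[OF p f] kant_spaceD(4)[OF q f] couplingsD[OF r]
    by (metis integrable_distr)+
  have "(\<integral>x. f x \<partial>p) = (\<integral>z. f (fst z) \<partial>r)"
    by (subst couplingsD(4)[OF r, symmetric], subst integral_distr) measurable
  moreover have "(\<integral>x. f x \<partial>q) = (\<integral>z. f (snd z) \<partial>r)"
    by (subst couplingsD(5)[OF r, symmetric], subst integral_distr) measurable
  ultimately have "(\<integral>x. f x \<partial>p) - (\<integral>x. f x \<partial>q) = (\<integral>z. f (fst z) - f (snd z) \<partial>r)"
    using int by simp
  then have "ennreal \<bar>(\<integral>x. f x \<partial>p) - (\<integral>x. f x \<partial>q)\<bar> \<le> (\<integral>\<^sup>+ z. norm (f (fst z) - f (snd z)) \<partial>r)"
    using integral_norm_bound_ennreal[of r "\<lambda>z. f (fst z) - f (snd z)"] int by simp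
  also have "\<dots> \<le> (\<integral>\<^sup>+ z. ennreal (d (fst z) (snd z)) \<partial>r)"
    using f couplingsD(3)[OF r]
    by (intro nn_integral_mono ennreal_leI) (auto simp: short_map_def dist_real_def)
  finally show ?thesis .
qed

lemma kant_dist_cost_finite:
  assumes "p \<in> kant_space M d" "q \<in> kant_space M d"
  shows "(INF r\<in>couplings M d p q. \<integral>\<^sup>+ z. ennreal (d (fst z) (snd z)) \<partial>r) < \<infinity>"
  using couplings_finite_cost[OF assms] by (metis (no_types, lifting) INF_lower order.strict_trans1)

lemma integral_diff_le_kant_dist:
  assumes p: "p \<in> kant_space M d" and q: "q \<in> kant_space M d" and f: "short_fun M d f"
  shows "\<bar>(\<integral>x. f x \<partial>p) - (\<integral>x. f x \<partial>q)\<bar> \<le> kant_dist M d p q"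
proof -
  let ?I = "INF r\<in>couplings M d p q. \<integral>\<^sup>+ z. ennreal (d (fst z) (snd z)) \<partial>r"
  have "ennreal \<bar>(\<integral>x. f x \<partial>p) - (\<integral>x. f x \<partial>q)\<bar> \<le> ?I"
    using integral_coupling_diff[OF p q _ f] by (intro INF_greatest)
  then have "enn2real (ennreal \<bar>(\<integral>x. f x \<partial>p) - (\<integral>x. f x \<partial>q)\<bar>) \<le> enn2real ?I"
    \<comment> \<open>Finiteness of the infimum matters here: \<open>enn2real\<close> sends infinity
      to 0 and is monotone only below it.\<close>
    using kant_dist_cost_finite[OF p q] by (intro enn2real_mono) auto
  then show ?thesis
    by (simp add: kant_dist_def)
qed

text \<open>Makes the inner integral in \<open>kant_avg\<close> measurable on the space of measures,
  so that it can be evaluated on finitely supported measures there.\<close>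

lemma short_fun_integral:
  assumes "short_fun M d f"
  shows "short_fun (kant_space M d) (kant_dist M d) (\<lambda>p. \<integral>x. f x \<partial>p)"
  using integral_diff_le_kant_dist[OF _ _ assms] by (auto simp: short_map_def dist_real_def)

lemma kant_dist_pos:
  assumes "p \<in> kant_space M d" "q \<in> kant_space M d" "p \<noteq> q"
  shows "0 < kant_dist M d p q"
proof -
  obtain f where "short_fun M d f" "(\<integral>x. f x \<partial>p) \<noteq> (\<integral>x. f x \<partial>q)"
    using kant_space_eqI assms by metis
  then show ?thesis
    using integral_diff_le_kant_dist[OF assms(1,2), of f] by linarith
qed

text \<open>
  Separation is all that is needed of the topology of the space of measures: finitely supported
  measures on it are then Radon. In particular no triangle inequality for \<^const>\<open>kant_dist\<close> enters.
\<close>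

lemma closedin_kant_singleton:
  assumes p: "p \<in> kant_space M d"
  shows "closedin (dist_topology (kant_space M d) (kant_dist M d)) {p}"
proof -
  have "\<exists>r>0. \<forall>y\<in>kant_space M d. kant_dist M d q y < r \<longrightarrow> y \<in> kant_space M d - {p}"
    if "q \<in> kant_space M d - {p}" for q
    using that p kant_dist_pos[of q p] by (intro exI[of _ "kant_dist M d q p"]) auto
  then show ?thesis
    using p unfolding closedin_def openin_dist_topology by auto
qed

section \<open>Point masses and the distance to them\<close>

lemma closedin_singleton: "x \<in> M \<Longrightarrow> closedin (dist_topology M d) {x}"
  by (simp add: dist_topology_eq_mtopology closedin_Hausdorff_singleton Hausdorff_space_mtopology)

lemma kant_delta_in_kant_space:
  assumes x: "x \<in> M"
  shows "kant_delta M d x \<in> kant_space M d"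
proof -
  have "distr (measure_pmf (return_pmf ())) (borel_of (dist_topology M d)) (\<lambda>_. x) = kant_delta M d x"
    unfolding kant_delta_def return_pmf.rep_eq using x by (subst distr_return) auto
  then show ?thesis
    using finite_support_in_kant_space[of "return_pmf ()" "\<lambda>_. x" M d] closedin_singleton x by auto
qed

lemma integral_kant_delta:
  assumes "x \<in> M" "short_fun M d f"
  shows "(\<integral>y. f y \<partial>kant_delta M d x) = f x"
  unfolding kant_delta_def using short_fun_measurable[OF assms(2)] assms(1)
  by (intro integral_return) auto

lemma dist_measurable:
  "(\<lambda>z. d (fst z) (snd z)) \<in> borel_measurable (borel_of (prod_topology mtopology mtopology))"
proof -
  have "mtopology_of Self = mtopology"
    by (simp add: mtopology_of_def)
  then have "continuous_map (prod_topology mtopology mtopology) euclidean (\<lambda>(x, y). d x y)"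
    using continuous_map_metric[of Self] by simp
  then show ?thesis
    using continuous_map_measurable_borel_of[of _ euclidean "\<lambda>(x, y). d x y"]
    by (simp add: borel_of_euclidean case_prod_beta')
qed

text \<open>The pushforward of \<open>p\<close> along \<open>y \<mapsto> (y, x)\<close> is a
  coupling, and its cost is the integral on the right.\<close>

lemma kant_dist_delta_le:
  assumes p: "p \<in> kant_space M d" and x: "x \<in> M"
  shows "kant_dist M d p (kant_delta M d x) \<le> (\<integral>y. d y x \<partial>p)"
proof -
  let ?T = "prod_topology mtopology mtopology"
  interpret p: prob_space p using kant_spaceD[OF p] by simp
  have sets_p: "sets p = sets (borel_of mtopology)"
    using kant_spaceD(2)[OF p] by (simp add: dist_topology_eq_mtopology)
  define r where "r = distr p (borel_of ?T) (\<lambda>y. (y, x))"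
  have "continuous_map mtopology ?T (\<lambda>y. (y, x))"
    using x by (simp add: continuous_map_pairwise o_def)
  then have m: "(\<lambda>y. (y, x)) \<in> p \<rightarrow>\<^sub>M borel_of ?T"
    using continuous_map_measurable_borel_of sets_p by (simp cong: measurable_cong_sets)
  have int: "integrable p (\<lambda>y. d y x)"
    using kant_spaceD(4)[OF p short_fun_dist[OF x]] .
  have "distr r (borel_of mtopology) fst = distr p (borel_of mtopology) (\<lambda>y. y)"
    unfolding r_def by (subst distr_distr[OF measurable_fst_snd_prod_borel_of(1) m])
      (simp add: o_def)
  also have "\<dots> = p"
    by (rule distr_id2) (simp add: sets_p)
  finally have 1: "distr r (borel_of mtopology) fst = p" .
  have "distr r (borel_of mtopology) snd = distr p (borel_of mtopology) (\<lambda>_. x)"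
    unfolding r_def by (subst distr_distr[OF measurable_fst_snd_prod_borel_of(2) m])
      (simp add: o_def)
  also have "\<dots> = return (borel_of mtopology) x"
    using x by (intro p.distr_const) simp
  finally have "r \<in> couplings M d p (kant_delta M d x)"
    using 1 p.prob_space_distr[OF m]
    by (simp add: couplings_def kant_delta_def dist_topology_eq_mtopology r_def)
  then have "(INF r\<in>couplings M d p (kant_delta M d x). \<integral>\<^sup>+ z. ennreal (d (fst z) (snd z)) \<partial>r)
      \<le> (\<integral>\<^sup>+ z. ennreal (d (fst z) (snd z)) \<partial>r)"
    by (rule INF_lower)
  also have "\<dots> = (\<integral>\<^sup>+ y. ennreal (d y x) \<partial>p)"
    unfolding r_def using m dist_measurable by (subst nn_integral_distr) simp_all
  also have "\<dots> = ennreal (\<integral>y. d y x \<partial>p)"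
    using int by (intro nn_integral_eq_integral) auto
  finally show ?thesis
    unfolding kant_dist_def by (intro enn2real_leI Bochner_Integration.integral_nonneg) auto
qed

end

section \<open>Conditioning a coupling\<close>

text \<open>The form without division includes null \<open>B\<close>, where both sides vanish. The
  splitting of an integral below can then be used even when the complement of the conditioning set
  is null.\<close>

lemma (in prob_space) prob_times_integral_uniform_measure:
  fixes f :: "'a \<Rightarrow> real"
  assumes B: "B \<in> events" and f: "f \<in> borel_measurable M"
  shows "prob B * (\<integral>x. f x \<partial>uniform_measure M B) = (\<integral>x. indicator B x * f x \<partial>M)"
proof (cases "prob B = 0")
  case True
  then have "emeasure M B = 0"
    by (simp add: emeasure_eq_measure)
  then have "AE x in M. x \<notin> B"
    by (intro AE_not_in null_setsI B)
  then have "(\<integral>x. indicator B x * f x \<partial>M) = (\<integral>x. 0 \<partial>M)"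
    using B f by (intro integral_cong_AE) auto
  then show ?thesis using True by simp
next
  case False
  then have pos: "prob B > 0"
    using measure_nonneg[of M B] by linarith
  have "uniform_measure M B = density M (\<lambda>x. ennreal (indicator B x / prob B))"
    unfolding uniform_measure_def using pos
    by (intro arg_cong[where f = "density M"] ext)
      (auto simp: emeasure_eq_measure divide_ennreal[of 1, simplified] split: split_indicator)
  then have "(\<integral>x. f x \<partial>uniform_measure M B) = (\<integral>x. indicator B x / prob B * f x \<partial>M)"
    using B f by (simp add: integral_density)
  then show ?thesis
    using pos by simp
qed

text \<open>Conditioning increases mass by at most the factor \<open>1 / measure r B\<close>, so the
  conditioned marginal is dominated by the original one.\<close>

lemma (in Metric_space) conditioned_in_kant_space:
  assumes "prob_space r" and g: "g \<in> r \<rightarrow>\<^sub>M borel_of mtopology"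
    and p: "distr r (borel_of mtopology) g \<in> kant_space M d"
    and B: "B \<in> sets r" "measure r B > 0"
  shows "distr (uniform_measure r B) (borel_of mtopology) g \<in> kant_space M d"
proof -
  interpret r: prob_space r by fact
  have "emeasure r B \<noteq> 0"
    using B by (simp add: r.emeasure_eq_measure)
  then interpret r1: prob_space "uniform_measure r B"
    by (intro prob_space_uniform_measure) auto
  have g1: "g \<in> uniform_measure r B \<rightarrow>\<^sub>M borel_of mtopology"
    using g by simp
  show ?thesis
  proof (rule dominated_in_kant_space[OF p])
    show "prob_space (distr (uniform_measure r B) (borel_of mtopology) g)"
      using g1 by (rule r1.prob_space_distr)
    show "1 / measure r B > 0"
      using B by simp
    fix X assume "X \<in> sets (distr r (borel_of mtopology) g)"
    then have X: "X \<in> sets (borel_of mtopology)" by simp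
    have gX: "g -` X \<inter> space r \<in> sets r"
      using g X by (rule measurable_sets)
    have "emeasure (distr (uniform_measure r B) (borel_of mtopology) g) X
        = emeasure r (B \<inter> (g -` X \<inter> space r)) / emeasure r B"
      using X g1 B gX by (simp add: emeasure_distr)
    also have "\<dots> \<le> emeasure r (g -` X \<inter> space r) / emeasure r B"
      using gX B by (intro divide_right_mono_ennreal emeasure_mono) auto
    also have "\<dots> = ennreal (1 / measure r B) * emeasure (distr r (borel_of mtopology) g) X"
      using X g B by (simp add: emeasure_distr r.emeasure_eq_measure divide_ennreal flip: ennreal_mult)
    finally show "emeasure (distr (uniform_measure r B) (borel_of mtopology) g) X
      \<le> ennreal (1 / measure r B) * emeasure (distr r (borel_of mtopology) g) X" .
  qed simp
qed

text \<open>The law of total expectation for a marginal of \<open>r\<close>; \<open>g\<close> will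
  be \<open>fst\<close> or \<open>snd\<close>.\<close>

lemma (in Metric_space) integral_split_conditioned:
  assumes "prob_space r" and g: "g \<in> r \<rightarrow>\<^sub>M borel_of mtopology"
    and p: "distr r (borel_of mtopology) g \<in> kant_space M d"
    and B: "B \<in> sets r" and f: "short_fun M d f"
  shows "(\<integral>x. f x \<partial>distr r (borel_of mtopology) g) =
    measure r B * (\<integral>x. f x \<partial>distr (uniform_measure r B) (borel_of mtopology) g) +
    (1 - measure r B) * (\<integral>x. f x \<partial>distr (uniform_measure r (space r - B)) (borel_of mtopology) g)"
proof -
  interpret r: prob_space r by fact
  have fm: "f \<in> borel_measurable (borel_of mtopology)"
    using short_fun_measurable[OF f] by (simp add: dist_topology_eq_mtopology)
  have fg: "(\<lambda>z. f (g z)) \<in> borel_measurable r"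
    using g fm by (rule measurable_compose)
  have int: "integrable r (\<lambda>z. f (g z))"
    using integrable_distr[OF g kant_spaceD(4)[OF p f]] .
  have um: "measure r C * (\<integral>x. f x \<partial>distr (uniform_measure r C) (borel_of mtopology) g)
      = (\<integral>z. indicator C z * f (g z) \<partial>r)" if "C \<in> sets r" for C
    using g fm r.prob_times_integral_uniform_measure[OF that fg] by (simp add: integral_distr)
  have "(\<integral>x. f x \<partial>distr r (borel_of mtopology) g) = (\<integral>z. f (g z) \<partial>r)"
    using g fm by (rule integral_distr)
  also have "\<dots> = (\<integral>z. indicator B z * f (g z) + indicator (space r - B) z * f (g z) \<partial>r)"
    by (intro Bochner_Integration.integral_cong) (auto split: split_indicator)
  also have "\<dots> = (\<integral>z. indicator B z * f (g z) \<partial>r) + (\<integral>z. indicator (space r - B) z * f (g z) \<partial>r)"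
    using B int integrable_mult_indicator[of _ r "\<lambda>z. f (g z)"]
    by (intro Bochner_Integration.integral_add) auto
  finally show ?thesis
    using um[OF B] um[of "space r - B"] B by (simp add: r.prob_compl)
qed

section \<open>Two-point means in an algebra\<close>

text \<open>\<open>bernoulli_pmf\<close> clips \<open>l\<close> to the unit interval, so this is a
  probability measure for every real \<open>l\<close>.\<close>

definition (in Metric_space) two_point :: "real \<Rightarrow> 'a \<Rightarrow> 'a \<Rightarrow> 'a measure" where
  "two_point l a b =
     distr (measure_pmf (bernoulli_pmf l)) (borel_of mtopology) (\<lambda>t. if t then a else b)"

lemma (in Metric_space) two_point_in_kant_space:
  assumes "a \<in> M" "b \<in> M"
  shows "two_point l a b \<in> kant_space M d"
  unfolding two_point_def dist_topology_eq_mtopology[symmetric]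
  using assms closedin_singleton by (intro finite_support_in_kant_space) auto

lemma (in Metric_space) integral_two_point:
  assumes "a \<in> M" "b \<in> M" "0 \<le> l" "l \<le> 1" "short_fun M d f"
  shows "(\<integral>x. f x \<partial>two_point l a b) = l * f a + (1 - l) * f b"
  unfolding two_point_def dist_topology_eq_mtopology[symmetric]
  using assms short_fun_measurable[OF assms(5)]
  by (subst integral_finite_support) (auto simp: mult.commute)

text \<open>Tossing one common coin for both measures pairs \<open>a\<close> with \<open>a'\<close>
  and \<open>b\<close> with \<open>b'\<close>, so the coupling never leaves
  \<open>R\<close>.\<close>

lemma (in ordered_Metric_space) two_point_stoch_order:
  assumes "(a, a') \<in> R" "(b, b') \<in> R"
  shows "(two_point l a b, two_point l a' b') \<in> stoch_order M d R"
proof -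
  let ?T = "prod_topology mtopology mtopology"
  let ?w = "measure_pmf (bernoulli_pmf l)"
  let ?h = "\<lambda>t. if t then (a, a') else (b, b')"
  have M: "a \<in> M" "a' \<in> M" "b \<in> M" "b' \<in> M"
    using assms closed_order closedin_subset by fastforce+
  have h: "?h \<in> ?w \<rightarrow>\<^sub>M borel_of ?T"
    using M by auto
  let ?r = "distr ?w (borel_of ?T) ?h"
  have "distr ?r (borel_of mtopology) fst = two_point l a b"
    "distr ?r (borel_of mtopology) snd = two_point l a' b'"
    unfolding two_point_def
    by (subst distr_distr[OF _ h]; force intro: measurable_fst_snd_prod_borel_of distr_cong simp: o_def)+
  moreover have "prob_space ?r"
    using h by (rule measure_pmf.prob_space_distr)
  ultimately have "?r \<in> couplings M d (two_point l a b) (two_point l a' b')"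
    by (simp add: couplings_def dist_topology_eq_mtopology)
  moreover have "M \<times> M - R \<in> sets (borel_of ?T)"
    using closed_order by (intro openin_sets_borel_of) (simp add: closedin_def)
  then have "emeasure ?r (M \<times> M - R) = emeasure ?w (?h -` (M \<times> M - R))"
    by (simp add: emeasure_distr[OF h])
  then have "emeasure ?r (M \<times> M - R) = 0"
    using assms by (simp add: vimage_def)
  ultimately show ?thesis
    using M two_point_in_kant_space unfolding stoch_order_def by blast
qed

context ordered_P_algebra
begin

lemma algebra_in_carrier: "p \<in> kant_space M d \<Longrightarrow> e p \<in> M"
  using short by (auto simp: short_map_def)

text \<open>The finitely supported measure \<open>\<mu>\<close> with atoms \<open>P i\<close>
  averages to \<open>p\<close>, and its image under \<open>e\<close> has atoms
  \<open>e (P i)\<close>; associativity equates the two values. The mixture is described by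
  integrals of short functions, which determine it.\<close>

lemma algebra_finite_mixture:
  assumes w: "finite (set_pmf w)" and P: "\<And>i. P i \<in> kant_space M d"
    and p: "p \<in> kant_space M d"
    and eq: "\<And>f. short_fun M d f \<Longrightarrow>
      (\<integral>x. f x \<partial>p) = measure_pmf.expectation w (\<lambda>i. \<integral>x. f x \<partial>P i)"
  shows "e p = e (distr (measure_pmf w) (borel_of mtopology) (\<lambda>i. e (P i)))"
proof -
  let ?K = "kant_space M d" and ?D = "kant_dist M d"
  define \<mu> where "\<mu> = distr (measure_pmf w) (borel_of (dist_topology ?K ?D)) P"
  have P_range: "range P \<subseteq> ?K"
    using P by auto
  have P_meas: "P \<in> measure_pmf w \<rightarrow>\<^sub>M borel_of (dist_topology ?K ?D)"
    using P by auto
  have \<mu>: "\<mu> \<in> kant_space ?K ?D"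
    unfolding \<mu>_def using w P_range closedin_kant_singleton by (rule finite_support_in_kant_space)
  have int: "(\<integral>q. (\<integral>x. f x \<partial>q) \<partial>\<mu>) = (\<integral>x. f x \<partial>p)" if f: "short_fun M d f" for f
    unfolding \<mu>_def eq[OF f]
    using P_range short_fun_measurable[OF short_fun_integral[OF f]] by (rule integral_finite_support)
  have "kant_avg M d \<mu> = p"
    unfolding kant_avg_def
  proof (rule the_equality)
    show "p \<in> ?K \<and> (\<forall>f. short_fun M d f \<longrightarrow> (\<integral>x. f x \<partial>p) = (\<integral>q. (\<integral>x. f x \<partial>q) \<partial>\<mu>))"
      using p int by simp
    fix m assume "m \<in> ?K \<and> (\<forall>f. short_fun M d f \<longrightarrow> (\<integral>x. f x \<partial>m) = (\<integral>q. (\<integral>x. f x \<partial>q) \<partial>\<mu>))"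
    then show "m = p"
      using p int by (intro kant_space_eqI) auto
  qed
  moreover have "kant_map M d e \<mu> = distr (measure_pmf w) (borel_of mtopology) (\<lambda>i. e (P i))"
  proof -
    have "e \<in> borel_of (dist_topology ?K ?D) \<rightarrow>\<^sub>M borel_of (dist_topology M d)"
      using short by (intro continuous_map_measurable_borel_of short_map_continuous)
    then show ?thesis
      unfolding kant_map_def \<mu>_def using P_meas
      by (subst distr_distr) (simp_all add: o_def dist_topology_eq_mtopology)
  qed
  ultimately show ?thesis
    using assoc[OF \<mu>] by simp
qed

text \<open>The abstract convex combination \<open>l a + (1 - l) b\<close> that the algebra
  structure provides.\<close>

definition mean :: "real \<Rightarrow> 'a \<Rightarrow> 'a \<Rightarrow> 'a" where
  "mean l a b = e (two_point l a b)"

text \<open>The two-component case of the previous lemma: \<open>e\<close> is affine.\<close>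

lemma algebra_mean:
  assumes l: "0 \<le> l" "l \<le> 1"
    and K: "p \<in> kant_space M d" "p1 \<in> kant_space M d" "p2 \<in> kant_space M d"
    and eq: "\<And>f. short_fun M d f \<Longrightarrow>
      (\<integral>x. f x \<partial>p) = l * (\<integral>x. f x \<partial>p1) + (1 - l) * (\<integral>x. f x \<partial>p2)"
  shows "e p = mean l (e p1) (e p2)"
proof -
  have "e p = e (distr (measure_pmf (bernoulli_pmf l)) (borel_of mtopology)
      (\<lambda>t. e (if t then p1 else p2)))"
    using K l eq by (intro algebra_finite_mixture) (auto simp: mult.commute)
  then show ?thesis
    by (simp add: mean_def two_point_def if_distrib)
qed

lemma mean_in_carrier: "a \<in> M \<Longrightarrow> b \<in> M \<Longrightarrow> mean l a b \<in> M"
  by (simp add: mean_def algebra_in_carrier two_point_in_kant_space)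

lemma mean_mono: "(a, a') \<in> R \<Longrightarrow> (b, b') \<in> R \<Longrightarrow> (mean l a b, mean l a' b') \<in> R"
  using monotone two_point_stoch_order by (auto simp: mean_def mono_rel_def)

text \<open>By the unit law \<open>x\<close> is the value of \<open>e\<close> at the point mass, so
  shortness of \<open>e\<close> compares \<open>p\<close> with that point mass.\<close>

lemma dist_algebra_le:
  assumes p: "p \<in> kant_space M d" and x: "x \<in> M"
  shows "d (e p) x \<le> (\<integral>y. d y x \<partial>p)"
proof -
  have "d (e p) (e (kant_delta M d x)) \<le> kant_dist M d p (kant_delta M d x)"
    using short p kant_delta_in_kant_space[OF x] by (simp add: short_map_def)
  then show ?thesis
    using kant_dist_delta_le[OF p x] unit[OF x] by simp
qed

text \<open>
  Both sides are brought to the combination of \<open>a\<close>, \<open>b\<close>, \<open>x\<close> with weights \<open>s m\<close>, \<open>s m\<close>, \<open>s (1 - m)\<close>,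
  where \<open>s = 1 / (1 + m)\<close>, which is symmetric in \<open>a\<close> and \<open>b\<close>.
\<close>

lemma mean_double:
  assumes M: "a \<in> M" "b \<in> M" "x \<in> M" and m: "0 < m" "m < 1"
    and eq: "mean m a x = mean m b x"
  shows "mean (2 * m / (1 + m)) a x = mean (2 * m / (1 + m)) b x"
proof -
  define s where "s = 1 / (1 + m)"
  have s: "0 \<le> s" "s \<le> 1" "1 - s = s * m" "2 * m / (1 + m) = 2 * s * m"
    using m by (auto simp: s_def field_simps)
  have sm: "0 \<le> 2 * s * m" "2 * s * m \<le> 1" "1 - 2 * s * m = s * (1 - m)"
    using m by (auto simp: s_def field_simps)
  \<comment> \<open>Adding weight \<open>1 - s = s * m\<close> at \<open>c\<close> to
    \<open>s\<close> times the mean of \<open>c\<close> and \<open>x\<close> gives \<open>c\<close>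
    the total weight \<open>2 * s * m\<close>.\<close>
  have same: "mean (2 * s * m) c x = mean s (mean m c x) c" if c: "c \<in> M" for c
  proof -
    have "e (two_point (2 * s * m) c x) = mean s (e (two_point m c x)) (e (kant_delta M d c))"
    proof (rule algebra_mean)
      fix f assume f: "short_fun M d f"
      have "2 * s * m * f c + (1 - 2 * s * m) * f x = s * (m * f c + (1 - m) * f x) + (1 - s) * f c"
        unfolding s(3) sm(3) by (simp add: algebra_simps)
      then show "(\<integral>y. f y \<partial>two_point (2 * s * m) c x) =
          s * (\<integral>y. f y \<partial>two_point m c x) + (1 - s) * (\<integral>y. f y \<partial>kant_delta M d c)"
        using c M m sm f by (simp add: integral_two_point integral_kant_delta)
    qed (use s c M in \<open>auto intro: two_point_in_kant_space kant_delta_in_kant_space\<close>)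
    then show ?thesis using unit[OF c] by (simp add: mean_def)
  qed
  have "mean s (mean m b x) a = mean s (mean m a x) b"
  proof -
    \<comment> \<open>Two independent coins produce the weights \<open>s * m\<close> at
      \<open>b\<close>, \<open>s * (1 - m)\<close> at \<open>x\<close> and \<open>1 - s\<close> at
      \<open>a\<close>. As \<open>1 - s = s * m\<close>, this one measure can be grouped as
      \<open>b\<close>, \<open>x\<close> against \<open>a\<close> or as \<open>a\<close>,
      \<open>x\<close> against \<open>b\<close>.\<close>
    let ?w = "pair_pmf (bernoulli_pmf s) (bernoulli_pmf m)"
    let ?g = "\<lambda>(t, u). if t then if u then b else x else a"
    let ?p = "distr (measure_pmf ?w) (borel_of (dist_topology M d)) ?g"
    have g: "range ?g \<subseteq> M" using M by auto
    have p: "?p \<in> kant_space M d"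
      using g closedin_singleton by (intro finite_support_in_kant_space) auto
    have int: "(\<integral>y. f y \<partial>?p) = s * m * f b + s * (1 - m) * f x + (1 - s) * f a"
      if f: "short_fun M d f" for f
    proof -
      have "(\<integral>y. f y \<partial>?p) = measure_pmf.expectation ?w (\<lambda>i. f (?g i))"
        using g short_fun_measurable[OF f] by (rule integral_finite_support)
      also have "\<dots> = (\<Sum>i\<in>UNIV. f (?g i) * pmf ?w i)"
        by (rule integral_measure_pmf_real) auto
      also have "\<dots> = s * m * f b + s * (1 - m) * f x + (1 - s) * f a"
        using m s unfolding UNIV_Times_UNIV[symmetric] UNIV_bool
        by (simp add: pmf_pair algebra_simps)
      finally show ?thesis .
    qed
    have "e ?p = mean s (e (two_point m b x)) (e (kant_delta M d a))"
      using s(1,2) M m p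
      by (intro algebra_mean two_point_in_kant_space kant_delta_in_kant_space)
        (simp_all add: integral_two_point integral_kant_delta int algebra_simps)
    moreover have "e ?p = mean s (e (two_point m a x)) (e (kant_delta M d b))"
      using s(1,2) M m p
      by (intro algebra_mean two_point_in_kant_space kant_delta_in_kant_space)
        (simp_all add: integral_two_point integral_kant_delta int s(3) algebra_simps)
    ultimately show ?thesis using M unit by (simp add: mean_def)
  qed
  then show ?thesis
    \<comment> \<open>In the form supplied by \<open>same\<close>, \<open>eq\<close> replaces the
      inner mean of \<open>a\<close> by that of \<open>b\<close>, the swap just shown exchanges
      \<open>a\<close> and \<open>b\<close>, and \<open>eq\<close> is applied once more.\<close>
    using same[OF M(1)] same[OF M(2)] eq s(4) by simp
qed

text \<open>
  By the previous lemma the equality persists for weights tending to \<open>1\<close>, at which the two means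
  tend to \<open>a\<close> and \<open>b\<close>.
\<close>

lemma mean_cancel:
  assumes M: "a \<in> M" "b \<in> M" "x \<in> M" and m: "0 < m" "m < 1"
    and eq: "mean m a x = mean m b x"
  shows "a = b"
proof -
  \<comment> \<open>Doubling maps \<open>1 - l\<close> to \<open>(1 - l) / (1 + l)\<close>; the
    invariant \<open>m \<le> l\<close> in the induction bounds the factor by
    \<open>c\<close>.\<close>
  define c where "c = 1 / (1 + m)"
  have c: "0 < c" "c < 1" using m by (auto simp: c_def)
  have ex: "\<exists>l. m \<le> l \<and> l < 1 \<and> 1 - l \<le> c ^ n \<and> mean l a x = mean l b x" for n
  proof (induction n)
    case 0
    then show ?case using m eq by (intro exI[of _ m]) auto
  next
    case (Suc n)
    then obtain l where l: "m \<le> l" "l < 1" "1 - l \<le> c ^ n" "mean l a x = mean l b x"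
      by blast
    have "mean (2 * l / (1 + l)) a x = mean (2 * l / (1 + l)) b x"
      using l m M by (intro mean_double) auto
    moreover have "l \<le> 2 * l / (1 + l)" "2 * l / (1 + l) < 1"
      using l m by (auto simp: field_simps mult_left_le)
    moreover have "1 - 2 * l / (1 + l) \<le> c ^ Suc n"
    proof -
      have "1 - 2 * l / (1 + l) = (1 / (1 + l)) * (1 - l)"
        using l m by (simp add: field_simps)
      also have "\<dots> \<le> c * c ^ n"
        using l m by (intro mult_mono) (auto simp: c_def intro: frac_le)
      finally show ?thesis by simp
    qed
    ultimately show ?case using l by (intro exI[of _ "2 * l / (1 + l)"]) auto
  qed
  \<comment> \<open>The mean distance to \<open>y\<close> under \<open>two_point l y x\<close> is
    \<open>(1 - l) * d x y\<close>, since the atom at \<open>y\<close> contributes nothing.\<close>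
  have near: "d (mean l y x) y \<le> (1 - l) * d x y" if "y \<in> M" "0 \<le> l" "l \<le> 1" for y l
    using dist_algebra_le[OF two_point_in_kant_space[of y x l], of y] that M
    by (simp add: mean_def integral_two_point short_fun_dist)
  have "d a b \<le> c ^ n * (d x a + d x b)" for n
  proof -
    obtain l where l: "m \<le> l" "l < 1" "1 - l \<le> c ^ n" "mean l a x = mean l b x"
      using ex by blast
    have "d a b \<le> d (mean l a x) a + d (mean l b x) b"
      using triangle''[of a "mean l a x" b] M mean_in_carrier l(4) by simp
    also have "\<dots> \<le> (1 - l) * (d x a + d x b)"
      using near[of a l] near[of b l] M l m by (simp add: algebra_simps)
    also have "\<dots> \<le> c ^ n * (d x a + d x b)"
      using l by (intro mult_right_mono) auto
    finally show ?thesis .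
  qed
  moreover have "(\<lambda>n. c ^ n * (d x a + d x b)) \<longlonglongrightarrow> 0"
    using c by (intro tendsto_mult_left_zero LIMSEQ_realpow_zero) auto
  ultimately have "d a b \<le> 0"
    by (intro LIMSEQ_le_const) auto
  then show ?thesis
    using M by (metis nonneg order_antisym zero)
qed

end

section \<open>Cancellation of the order\<close>

text \<open>If all such boxes were null, so would be the union of the countably many with centres in
  \<open>D1\<close> and \<open>D2\<close> and radius \<open>1 / Suc n\<close>. Up to a null set
  these cover everything off the diagonal, so \<open>fst\<close> and \<open>snd\<close> agree almost
  everywhere and the marginals coincide.\<close>

lemma (in Metric_space) coupling_charges_box:
  assumes p: "p \<in> kant_space M d" and q: "q \<in> kant_space M d" and r: "r \<in> couplings M d p q"
    and "p \<noteq> q"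
  obtains x y \<epsilon> where "x \<in> M" "y \<in> M" "2 * \<epsilon> < d x y" "measure r (mball x \<epsilon> \<times> mball y \<epsilon>) > 0"
proof (rule ccontr)
  note box = that
  interpret r: prob_space r using couplingsD[OF r] by simp
  assume no_box: "\<not> thesis"
  have null: "measure r (mball x \<epsilon> \<times> mball y \<epsilon>) = 0"
    if "x \<in> M" "y \<in> M" "2 * \<epsilon> < d x y" for x y \<epsilon>
    using box[OF that] no_box by (auto simp: zero_less_measure_iff)
  obtain D1 where D1: "countable D1" "D1 \<subseteq> M" "AE y in p. \<forall>e>0. \<exists>x\<in>D1. d x y < e"
    using kant_space_separable[OF p] .
  obtain D2 where D2: "countable D2" "D2 \<subseteq> M" "AE y in q. \<forall>e>0. \<exists>x\<in>D2. d x y < e"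
    using kant_space_separable[OF q] .
  have AE1: "AE z in r. \<forall>e>0. \<exists>x\<in>D1. d x (fst z) < e"
    using D1(3) unfolding couplingsD(4)[OF r, symmetric] by (rule AE_distrD[OF couplingsD(6)[OF r]])
  have AE2: "AE z in r. \<forall>e>0. \<exists>x\<in>D2. d x (snd z) < e"
    using D2(3) unfolding couplingsD(5)[OF r, symmetric] by (rule AE_distrD[OF couplingsD(7)[OF r]])
  let ?I = "{(x, y, n::nat) \<in> D1 \<times> D2 \<times> UNIV. 2 * (1 / Suc n) < d x y}"
  let ?B = "\<lambda>(x, y, n::nat). mball x (1 / Suc n) \<times> mball y (1 / Suc n)"
  have countable_I: "countable ?I"
    by (rule countable_subset[of _ "D1 \<times> D2 \<times> UNIV"]) (use D1 D2 in auto)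
  have "AE z in r. z \<notin> ?B i" if i: "i \<in> ?I" for i
  proof -
    obtain x y n where xyn: "i = (x, y, n)" "x \<in> D1" "y \<in> D2" "2 * (1 / Suc n) < d x y"
      using i by auto
    have "?B i \<in> sets r"
      unfolding couplingsD(2)[OF r] xyn(1)
      by (simp add: openin_sets_borel_of openin_prod_Times_iff)
    moreover have "emeasure r (?B i) = 0"
      using null[of x y "1 / Suc n"] xyn D1(2) D2(2) by (auto simp: r.emeasure_eq_measure)
    ultimately show ?thesis by (intro AE_not_in null_setsI)
  qed
  then have AE3: "AE z in r. \<forall>i\<in>?I. z \<notin> ?B i"
    unfolding AE_ball_countable[OF countable_I] by blast
  have "AE z in r. fst z = snd z"
    using AE1 AE2 AE3 AE_space
  proof eventually_elim
    case (elim z)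
    define a b where "a = fst z" and "b = snd z"
    have z: "z = (a, b)" by (simp add: a_def b_def)
    have M: "a \<in> M" "b \<in> M" using elim(4) couplingsD(3)[OF r] z by auto
    show ?case
    proof (rule ccontr)
      assume "fst z \<noteq> snd z"
      \<comment> \<open>With \<open>d a b\<close> above \<open>4 / Suc n\<close>, moving each point
        by less than \<open>1 / Suc n\<close> leaves the centres more than \<open>2 / Suc n\<close>
        apart.\<close>
      then have "d a b / 4 > 0" using M z by auto
      then obtain n where n: "1 / Suc n < d a b / 4" using nat_approx_posE by blast
      have pos: "0 < 1 / real (Suc n)" by simp
      obtain x where x: "x \<in> D1" "d x a < 1 / Suc n"
        using elim(1) pos unfolding a_def by blast
      obtain y where y: "y \<in> D2" "d y b < 1 / Suc n"
        using elim(2) pos unfolding b_def by blast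
      have xyM: "x \<in> M" "y \<in> M" using x y D1 D2 by auto
      have "d a b \<le> d x a + d x b" "d x b \<le> d x y + d y b"
        using triangle''[of a x b] triangle[of x y b] M xyM by auto
      then have "2 * (1 / Suc n) < d x y" using x y n by linarith
      then have "(x, y, n) \<in> ?I" using x y by auto
      then have "z \<notin> ?B (x, y, n)" using elim(3) by blast
      then show False using x y xyM M z by simp
    qed
  qed
  then have "distr r (borel_of mtopology) fst = distr r (borel_of mtopology) snd"
    using couplingsD[OF r] by (intro distr_cong_AE) auto
  then show False
    using couplingsD[OF r] \<open>p \<noteq> q\<close> by simp
qed

lemma (in ordered_P_algebra) dist_algebra_ball:
  assumes p: "p \<in> kant_space M d" and x: "x \<in> M" and AE: "AE y in p. d y x \<le> \<epsilon>"
  shows "d (e p) x \<le> \<epsilon>"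
proof -
  interpret p: prob_space p using kant_spaceD[OF p] by simp
  have "(\<integral>y. d y x \<partial>p) \<le> \<epsilon>"
    using kant_spaceD(4)[OF p short_fun_dist[OF x]] AE by (rule p.integral_le_const)
  then show ?thesis
    using dist_algebra_le[OF p x] by linarith
qed

lemma (in Metric_space) AE_conditioned_ball:
  assumes g: "g \<in> r \<rightarrow>\<^sub>M borel_of mtopology" and B: "B \<in> sets r" "\<And>z. z \<in> B \<Longrightarrow> g z \<in> mball x \<epsilon>"
    and x: "x \<in> M"
  shows "AE y in distr (uniform_measure r B) (borel_of mtopology) g. d y x \<le> \<epsilon>"
proof -
  have "(\<lambda>y. d y x) \<in> borel_measurable (borel_of mtopology)"
    using short_fun_measurable[OF short_fun_dist[OF x]] by (simp add: dist_topology_eq_mtopology)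
  then have "{y \<in> space (borel_of mtopology). d y x \<le> \<epsilon>} \<in> sets (borel_of mtopology)"
    by measurable
  moreover have "AE z in uniform_measure r B. d (g z) x \<le> \<epsilon>"
    using B by (intro AE_uniform_measureI) (auto simp: commute less_imp_le)
  ultimately show ?thesis
    using g by (subst AE_distr_iff) auto
qed

text \<open>The conditioned measure couples its own marginals, and it inherits the null sets of
  \<open>r\<close>, among them the complement of \<open>R\<close>.\<close>

lemma (in ordered_Metric_space) conditioned_stoch_order:
  assumes p: "p \<in> kant_space M d" and q: "q \<in> kant_space M d" and r: "r \<in> couplings M d p q"
    and supp: "emeasure r (M \<times> M - R) = 0" and B: "B \<in> sets r" "measure r B > 0"
  shows "(distr (uniform_measure r B) (borel_of mtopology) fst,
    distr (uniform_measure r B) (borel_of mtopology) snd) \<in> stoch_order M d R"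
    (is "(?p, ?q) \<in> _")
proof -
  interpret r: prob_space r using couplingsD[OF r] by simp
  let ?r = "uniform_measure r B"
  have eB: "emeasure r B \<noteq> 0"
    using B by (simp add: r.emeasure_eq_measure)
  have "?p \<in> kant_space M d" "?q \<in> kant_space M d"
    using conditioned_in_kant_space[OF _ _ _ B] couplingsD[OF r] p q by auto
  moreover have "?r \<in> couplings M d ?p ?q"
    using couplingsD(2)[OF r] eB
    by (simp add: couplings_def dist_topology_eq_mtopology prob_space_uniform_measure)
  moreover have "emeasure ?r (M \<times> M - R) = 0"
  proof -
    have R: "M \<times> M - R \<in> sets r"
      unfolding couplingsD(2)[OF r]
      using closed_order by (intro openin_sets_borel_of) (simp add: closedin_def)
    then have "emeasure r (B \<inter> (M \<times> M - R)) \<le> emeasure r (M \<times> M - R)"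
      by (intro emeasure_mono) auto
    then show ?thesis
      using R B supp by simp
  qed
  ultimately show ?thesis
    unfolding stoch_order_def by blast
qed

lemma (in ordered_P_algebra) stoch_order_eqI:
  assumes p: "p \<in> kant_space M d" and q: "q \<in> kant_space M d"
    and pq: "(p, q) \<in> stoch_order M d R" and eq: "e p = e q"
  shows "p = q"
proof (rule ccontr)
  assume "p \<noteq> q"
  obtain r where r: "r \<in> couplings M d p q" and supp: "emeasure r (M \<times> M - R) = 0"
    using pq by (auto simp: stoch_order_def)
  note rD = couplingsD[OF r]
  interpret r: prob_space r by (rule rD(1))
  obtain x y \<epsilon> where box: "x \<in> M" "y \<in> M" "2 * \<epsilon> < d x y" "measure r (mball x \<epsilon> \<times> mball y \<epsilon>) > 0"
    using coupling_charges_box[OF p q r \<open>p \<noteq> q\<close>] .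
  define B where "B = mball x \<epsilon> \<times> mball y \<epsilon>"
  define l where "l = measure r B"
  have B: "B \<in> sets r" "0 < measure r B"
    unfolding rD(2) B_def using box by (simp_all add: openin_sets_borel_of openin_prod_Times_iff)
  define P where "P C = distr (uniform_measure r C) (borel_of mtopology) fst" for C
  define Q where "Q C = distr (uniform_measure r C) (borel_of mtopology) snd" for C
  have K: "P C \<in> kant_space M d" "Q C \<in> kant_space M d" "(e (P C), e (Q C)) \<in> R"
    if "C \<in> sets r" "0 < measure r C" for C
    using conditioned_stoch_order[OF p q r supp that] monotone
    unfolding P_def Q_def stoch_order_def mono_rel_def by auto
  have close: "d (e (P B)) x \<le> \<epsilon>" "d (e (Q B)) y \<le> \<epsilon>"
    unfolding P_def Q_def using K[OF B] rD B box
    by (auto intro!: dist_algebra_ball AE_conditioned_ball simp: P_def Q_def B_def)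
  have p_split: "(\<integral>x. f x \<partial>p) = l * (\<integral>x. f x \<partial>P B) + (1 - l) * (\<integral>x. f x \<partial>P (space r - B))"
    if "short_fun M d f" for f
    using integral_split_conditioned[OF rD(1) rD(6) _ B(1) that] p rD(4) by (simp add: P_def l_def)
  have q_split: "(\<integral>x. f x \<partial>q) = l * (\<integral>x. f x \<partial>Q B) + (1 - l) * (\<integral>x. f x \<partial>Q (space r - B))"
    if "short_fun M d f" for f
    using integral_split_conditioned[OF rD(1) rD(7) _ B(1) that] q rD(5) by (simp add: Q_def l_def)
  have "e (P B) = e (Q B)"
  \<comment> \<open>For \<open>l = 1\<close> the complement of \<open>B\<close> is null and cannot
    be conditioned on, but then \<open>P B\<close> and \<open>Q B\<close> are \<open>p\<close> and
    \<open>q\<close> themselves.\<close>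
  proof (cases "l = 1")
    case True
    then have "p = P B" "q = Q B"
      using p_split q_split p q K[OF B] by (auto intro!: kant_space_eqI)
    then show ?thesis using eq by simp
  next
    case False
    then have l: "0 < l" "l < 1"
      using B(2) r.prob_le_1[of B] by (auto simp: l_def less_le)
    let ?C = "space r - B"
    have C: "?C \<in> sets r" "0 < measure r ?C"
      using B l by (auto simp: r.prob_compl l_def)
    \<comment> \<open>The two arguments of \<open>mean\<close> are raised one at a time; keeping
      \<open>c\<close> fixed in the first move yields two means with a common second argument, as
      cancellation requires.\<close>
    define c where "c = e (P ?C)"
    have M: "e (P B) \<in> M" "e (Q B) \<in> M" "c \<in> M"
      using K[OF B] K[OF C] algebra_in_carrier by (auto simp: c_def)
    have refl: "(z, z) \<in> R" if "z \<in> M" for z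
      using partial_order that by (auto simp: partial_order_on_def preorder_on_def refl_on_def)
    have "mean l (e (P B)) c = e p"
      unfolding c_def using l p K[OF B] K[OF C] p_split by (intro algebra_mean[symmetric]) auto
    moreover have "mean l (e (Q B)) (e (Q ?C)) = e q"
      using l q K[OF B] K[OF C] q_split by (intro algebra_mean[symmetric]) auto
    moreover have "(mean l (e (P B)) c, mean l (e (Q B)) c) \<in> R"
      using K[OF B] refl M by (intro mean_mono) auto
    moreover have "(mean l (e (Q B)) c, mean l (e (Q B)) (e (Q ?C))) \<in> R"
      unfolding c_def using K[OF C] refl M by (intro mean_mono) auto
    \<comment> \<open>The middle mean lies between \<open>e p\<close> and \<open>e q\<close>, which
      are equal.\<close>
    ultimately have "mean l (e (P B)) c = mean l (e (Q B)) c"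
      using partial_order eq by (auto simp: partial_order_on_def dest: antisymD)
    then show ?thesis
      using mean_cancel M l by blast
  qed
  then have "d x y \<le> d (e (P B)) x + d (e (Q B)) y"
    using triangle''[of x "e (P B)" y] box K[OF B] algebra_in_carrier by simp
  then show False
    using close box by linarith
qed

theorem proposition6p2p1:
  fixes A :: "'a set" and d :: "'a \<Rightarrow> 'a \<Rightarrow> real" and R :: "'a rel"
    and e :: "'a measure \<Rightarrow> 'a" and p q :: "'a measure"
  assumes "ordered_P_algebra A d R e"
    and "p \<in> kant_space A d" and "q \<in> kant_space A d"
    and "(p, q) \<in> stoch_order A d R"
    and "e p = e q"
  shows "p = q"
  using assms by (rule ordered_P_algebra.stoch_order_eqI)

end
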